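(* Let $F_0, F_1 \in \mathbb{K}[t,v,w,x,y,z]$ be irreducible polynomials that follow $\mathbf{h}$, with $F_0$ a factor of $\mathrm{Res}_{su}(\mathbf{x}\mathbf{A},\mathbf{x}\mathbf{C})$ and $F_1$ a factor of $\mathrm{Res}_{su}(\mathbf{x}\mathbf{B},\mathbf{x}\mathbf{C})$. If $F_0$ and $F_1$ are not associates (i.e. do not differ by a unit multiple), then $\mathrm{Res}_{tv}(F_0,F_1)$ is a nonzero polynomial in $\mathbb{K}[w,x,y,z]$. Moreover, $\mathrm{Res}_{tv}(F_0,F_1) = EF$ for polynomials $E,F\in\mathbb{K}[w,x,y,z]$, where $F$ is the implicit equation of $X_{\mathbf{h}}$.
   Context: $\mathbb{K}$ is an algebraically closed field of characteristic zero and $R=\mathbb{K}[s,u,t,v]$, bigraded by giving $s,u$ bidegree $(1,0)$ and $t,v$ bidegree $(0,1)$. Let $\mathbf{f}=(f_0,f_1,f_2,f_3)$ with $f_i\in\mathbb{K}[s,u]$ homogeneous of degree $m\ge 1$, and $\mathbf{g}=(g_0,g_1,g_2,g_3)$ with $g_i\in\mathbb{K}[t,v]$ homogeneous of degree $n\geq 1$, where $\gcd(f_0,\dots,f_3)=1=\gcd(g_0,\dots,g_3)$ and $f_0\neq 0$, $g_0\ne 0$. Let $\mathbf{h}=(h_0,h_1,h_2,h_3)$ with $h_i=f_0g_i+f_ig_0\in R$; it defines a rational map $\mathbb{P}^1\times\mathbb{P}^1\dashrightarrow\mathbb{P}^3$ with image $X_{\mathbf{h}}$, which is assumed to be a surface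 (its Zariski closure has dimension 2). The implicit equation of $X_{\mathbf{h}}$ is the irreducible homogeneous polynomial in $\mathbb{K}[w,x,y,z]$ (unique up to unit) whose zero locus in $\mathbb{P}^3$ is the Zariski closure of $X_{\mathbf{h}}$. The module $\mathrm{syz}(\mathbf{f})$ of syzygies of $(f_0,f_1,f_2,f_3)$ over $\mathbb{K}[s,u]$ is graded free of rank 3; let $\mathbf{a},\mathbf{b},\mathbf{c}$ (column vectors of length 4) be a homogeneous basis, with entries homogeneous of degrees $\mu_1\le\mu_2\le\mu_3$ respectively, $\mu_1+\mu_2+\mu_3=m$. Let $$N_{\mathbf{g}}=\begin{bmatrix}\frac{g_0}{2}&-\frac{g_1}{2}&-\frac{g_2}{2}&-\frac{g_3}{2}\\0&g_0&0&0\\0&0&g_0&0\\0&0&0&g_0\end{bmatrix}.$$ For a vector, $\gcd(\cdot)$ is the greatest common divisor in $R$ of its entries. Set $\mathbf{A}=\frac{N_{\mathbf{g}}\mathbf{a}}{\gcd(N_{\mathbf{g}}\mathbf{a})}$, $\mathbf{B}=\frac{N_{\mathbf{g}}\mathbf{b}}{\gcd(N_{\mathbf{g}}\mathbf{b})}$, $\mathbf{C}=\frac{N_{\mathbf{g}}\mathbf{c}}{\gcd(N_{\mathbf{g}}\mathbf{c})}$. Let $\mathbf{x}=[w,x,y,z]$ be coordinates on $\mathbb{P}^3$; then $\mathbf{x}\mathbf{A},\mathbf{x}\mathbf{B},\mathbf{x}\mathbf{C}\in R[w,x,y,z]$ are homogeneous in $s,u$ of degrees $\mu_1,\mu_2,\mu_3$.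 A polynomial $P\in R[w,x,y,z]$ homogeneous in $w,x,y,z$ (a moving surface) follows $\mathbf{h}$ if $P(h_0,h_1,h_2,h_3)=0$ in $R$. For polynomials $p,q$ homogeneous of degrees $d,e$ in two variables over a UFD, $\mathrm{Res}(p,q)$ is the determinant of the homogeneous Sylvester $(d+e)\times(d+e)$ matrix ($e$ shifted rows of coefficients of $p$, then $d$ shifted rows of coefficients of $q$; the empty determinant is $1$). $\mathrm{Res}_{su}$ is taken with respect to $s,u$ (coefficients in $\mathbb{K}[t,v,w,x,y,z]$), and $\mathrm{Res}_{tv}$ with respect to $t,v$ (coefficients in $\mathbb{K}[w,x,y,z]$). *)

theory Defs
  imports
    "HOL-Library.Poly_Mapping"
    "HOL-Library.Extended_Nat"
    "HOL-Computational_Algebra.Polynomial"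
    "Jordan_Normal_Form.Determinant"
    "Subresultants.Resultant_Prelim"
begin

subsection \<open>Polynomials in the eight variables\<close>

text \<open>All polynomials live in the single ring \<open>\<K>[s,u,t,v,w,x,y,z]\<close>, and \<open>polys V\<close> is its
  polynomial subring in the variables \<open>V\<close>. Over a domain a divisor of a nonzero element of
  \<open>polys V\<close> is again in \<open>polys V\<close>, and the units are the units of the coefficients. Hence \<open>irreducible\<close>,
  divisibility by an irreducible, associatedness and gcds mean the same in the big ring as
  in the subring.\<close>

datatype var = S | U | T | V | W | X | Y | Z

text \<open>The order on variables is arbitrary. It is there because the library makes
  \<open>'k mpol\<close> an integral domain only for linearly ordered variables.\<close>

fun var_index :: "var \<Rightarrow> nat" where
  "var_index S = 0" | "var_index U = 1" | "var_index T = 2" | "var_index V = 3"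
| "var_index W = 4" | "var_index X = 5" | "var_index Y = 6" | "var_index Z = 7"

lemma var_index_inject: "var_index a = var_index b \<Longrightarrow> a = b"
  by (cases a; cases b) simp_all

instantiation var :: linorder
begin

definition less_eq_var :: "var \<Rightarrow> var \<Rightarrow> bool" where
  "less_eq_var a b \<longleftrightarrow> var_index a \<le> var_index b"

definition less_var :: "var \<Rightarrow> var \<Rightarrow> bool" where
  "less_var a b \<longleftrightarrow> var_index a < var_index b"

instance
  by standard (auto simp: less_eq_var_def less_var_def intro: var_index_inject)

end

type_synonym monomial = "var \<Rightarrow>\<^sub>0 nat"
type_synonym 'k mpol = "monomial \<Rightarrow>\<^sub>0 'k"

definition Const :: "'k::zero \<Rightarrow> 'k mpol" where
  "Const c = Poly_Mapping.single 0 c"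

definition Var :: "var \<Rightarrow> 'k::zero_neq_one mpol" where
  "Var i = Poly_Mapping.single (Poly_Mapping.single i 1) 1"

definition polys :: "var set \<Rightarrow> 'k::zero mpol set" where
  "polys I = {p. \<forall>m\<in>Poly_Mapping.keys p. Poly_Mapping.keys m \<subseteq> I}"

definition mon_deg :: "var set \<Rightarrow> monomial \<Rightarrow> nat" where
  "mon_deg I m = (\<Sum>i\<in>I. Poly_Mapping.lookup m i)"

definition homog_in :: "var set \<Rightarrow> nat \<Rightarrow> 'k::zero mpol \<Rightarrow> bool" where
  "homog_in I d p \<longleftrightarrow> (\<forall>m\<in>Poly_Mapping.keys p. mon_deg I m = d)"

definition deg_in :: "var set \<Rightarrow> 'k::zero mpol \<Rightarrow> nat" where
  "deg_in I p = Max (insert 0 (mon_deg I ` Poly_Mapping.keys p))"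

definition eval_mpol :: "('k::zero \<Rightarrow> 'b::comm_ring_1) \<Rightarrow> (var \<Rightarrow> 'b) \<Rightarrow> 'k mpol \<Rightarrow> 'b" where
  "eval_mpol c \<sigma> p = (\<Sum>m\<in>Poly_Mapping.keys p.
     c (Poly_Mapping.lookup p m) * (\<Prod>i\<in>Poly_Mapping.keys m. \<sigma> i ^ Poly_Mapping.lookup m i))"

primrec assign :: "'b \<Rightarrow> 'b \<Rightarrow> 'b \<Rightarrow> 'b \<Rightarrow> 'b vec \<Rightarrow> var \<Rightarrow> 'b" where
  "assign s u t v q S = s"
| "assign s u t v q U = u"
| "assign s u t v q T = t"
| "assign s u t v q V = v"
| "assign s u t v q W = q $ 0"
| "assign s u t v q X = q $ 1"
| "assign s u t v q Y = q $ 2"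
| "assign s u t v q Z = q $ 3"

definition is_gcd_of :: "'r::comm_semiring_1 \<Rightarrow> 'r set \<Rightarrow> bool" where
  "is_gcd_of d A \<longleftrightarrow> (\<forall>a\<in>A. d dvd a) \<and> (\<forall>e. (\<forall>a\<in>A. e dvd a) \<longrightarrow> e dvd d)"

text \<open>\<open>A = y / gcd y\<close>, where the gcd, and hence \<open>A\<close>, is determined up to a unit.\<close>

definition is_div_by_gcd :: "'r::comm_ring_1 vec \<Rightarrow> 'r vec \<Rightarrow> bool" where
  "is_div_by_gcd A y \<longleftrightarrow> (\<exists>d. is_gcd_of d (set\<^sub>v y) \<and> y = d \<cdot>\<^sub>v A)"

subsection \<open>Homogeneous resultants\<close>

text \<open>The coefficient of \<open>a\<^sup>i b\<^sup>j\<close> in \<open>p\<close>, a polynomial in the variables other than \<open>a\<close>, \<open>b\<close>.\<close>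

definition coeff_at :: "var \<Rightarrow> var \<Rightarrow> nat \<Rightarrow> nat \<Rightarrow> 'k::comm_monoid_add mpol \<Rightarrow> 'k mpol" where
  "coeff_at a b i j p =
     (\<Sum>m | m \<in> Poly_Mapping.keys p \<and> Poly_Mapping.lookup m a = i \<and> Poly_Mapping.lookup m b = j.
        Poly_Mapping.single (m - Poly_Mapping.single a i - Poly_Mapping.single b j)
          (Poly_Mapping.lookup p m))"

text \<open>The dehomogenization at \<open>b = 1\<close> of a form \<open>p\<close> of degree \<open>d\<close> in \<open>a\<close>, \<open>b\<close>. Its degree may
  drop below \<open>d\<close>, so the resultant must use a Sylvester matrix of prescribed
  size (\<open>resultant_sub\<close> rather than \<open>resultant\<close>) and depends on the form degrees \<open>d\<close>, \<open>e\<close>.\<close>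

definition dehom :: "var \<Rightarrow> var \<Rightarrow> nat \<Rightarrow> 'k::comm_ring_1 mpol \<Rightarrow> 'k mpol poly" where
  "dehom a b d p = (\<Sum>k\<le>d. monom (coeff_at a b k (d - k) p) k)"

definition hom_resultant ::
  "var \<Rightarrow> var \<Rightarrow> nat \<Rightarrow> nat \<Rightarrow> 'k::comm_ring_1 mpol \<Rightarrow> 'k mpol \<Rightarrow> 'k mpol" where
  "hom_resultant a b d e p q = resultant_sub d e (dehom a b d p) (dehom a b e q)"

subsection \<open>Zariski topology on \<open>\<P>\<^sup>3\<close>\<close>

text \<open>A point of \<open>\<P>\<^sup>3\<close> is given by any of its representatives in \<open>\<K>\<^sup>4 - {0}\<close>, and a subset of
  \<open>\<P>\<^sup>3\<close> by the set of all representatives of its points.\<close>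

definition proj3 :: "'k::field vec set" where
  "proj3 = carrier_vec 4 - {0\<^sub>v 4}"

text \<open>Only evaluated at elements of \<open>\<K>[w,x,y,z]\<close>, so the values for \<open>s,u,t,v\<close> are irrelevant.\<close>

definition eval_pt :: "'k::field vec \<Rightarrow> 'k mpol \<Rightarrow> 'k" where
  "eval_pt q = eval_mpol id (assign 0 0 0 0 q)"

definition forms :: "'k::field mpol set" where
  "forms = {G \<in> polys {W,X,Y,Z}. \<exists>k. homog_in {W,X,Y,Z} k G}"

definition zero_locus :: "'k::field mpol set \<Rightarrow> 'k vec set" where
  "zero_locus I = {q \<in> proj3. \<forall>G\<in>I. eval_pt q G = 0}"

definition zariski_closed :: "'k::field vec set \<Rightarrow> bool" where
  "zariski_closed C \<longleftrightarrow> (\<exists>I\<subseteq>forms. C = zero_locus I)"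

definition zariski_closure :: "'k::field vec set \<Rightarrow> 'k vec set" where
  "zariski_closure A = \<Inter>{C. zariski_closed C \<and> A \<subseteq> C}"

definition zariski_irreducible :: "'k::field vec set \<Rightarrow> bool" where
  "zariski_irreducible A \<longleftrightarrow> A \<noteq> {} \<and>
     (\<forall>C D. zariski_closed C \<and> zariski_closed D \<and> A \<subseteq> C \<union> D \<longrightarrow> A \<subseteq> C \<or> A \<subseteq> D)"

text \<open>Krull dimension of a closed set: the supremum of the lengths \<open>n\<close> of chains
  \<open>C\<^sub>0 \<subset> \<dots> \<subset> C\<^sub>n\<close> of irreducible closed subsets.\<close>

definition zariski_dim :: "'k::field vec set \<Rightarrow> enat" where
  "zariski_dim A = Sup {enat n | n. \<exists>C :: nat \<Rightarrow> 'k vec set.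
     (\<forall>i\<le>n. zariski_closed (C i) \<and> zariski_irreducible (C i) \<and> C i \<subseteq> A) \<and>
     (\<forall>i<n. C i \<subset> C (Suc i))}"

subsection \<open>The rational map \<open>\<h>\<close>\<close>

definition par_map :: "'k::field mpol vec \<Rightarrow> 'k mpol vec \<Rightarrow> 'k mpol vec" where
  "par_map f g = vec 4 (\<lambda>i. f $ 0 * g $ i + f $ i * g $ 0)"

text \<open>The base points, where \<open>h\<close> vanishes, contribute nothing since \<open>0 \<notin> proj3\<close>.\<close>

definition image_of :: "'k::field mpol vec \<Rightarrow> 'k vec set" where
  "image_of h = {q \<in> proj3. \<exists>s u t v c. (s, u) \<noteq> (0, 0) \<and> (t, v) \<noteq> (0, 0) \<and> c \<noteq> 0 \<and>
     q = c \<cdot>\<^sub>v map_vec (eval_mpol id (assign s u t v (0\<^sub>v 4))) h}"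

definition is_implicit_equation :: "'k::field mpol vec \<Rightarrow> 'k mpol \<Rightarrow> bool" where
  "is_implicit_equation h F \<longleftrightarrow>
     F \<in> forms \<and> irreducible F \<and> zero_locus {F} = zariski_closure (image_of h)"

definition follows :: "'k::field mpol \<Rightarrow> 'k mpol vec \<Rightarrow> bool" where
  "follows P h \<longleftrightarrow> (\<exists>k. homog_in {W,X,Y,Z} k P) \<and>
     eval_mpol Const (assign (Var S) (Var U) (Var T) (Var V) h) P = 0"

subsection \<open>Syzygies and moving planes\<close>

definition syz :: "'k::field mpol vec \<Rightarrow> 'k mpol vec set" where
  "syz f = {a \<in> carrier_vec 4. set\<^sub>v a \<subseteq> polys {S,U} \<and> a \<bullet> f = 0}"

definition is_syz_basis ::
  "'k::field mpol vec \<Rightarrow> 'k mpol vec \<Rightarrow> 'k mpol vec \<Rightarrow> 'k mpol vec \<Rightarrow> bool" where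
  "is_syz_basis f a b c \<longleftrightarrow> a \<in> syz f \<and> b \<in> syz f \<and> c \<in> syz f \<and>
     (\<forall>p\<in>syz f. \<exists>\<alpha>\<in>polys {S,U}. \<exists>\<beta>\<in>polys {S,U}. \<exists>\<gamma>\<in>polys {S,U}.
        p = \<alpha> \<cdot>\<^sub>v a + \<beta> \<cdot>\<^sub>v b + \<gamma> \<cdot>\<^sub>v c) \<and>
     (\<forall>\<alpha>\<in>polys {S,U}. \<forall>\<beta>\<in>polys {S,U}. \<forall>\<gamma>\<in>polys {S,U}.
        \<alpha> \<cdot>\<^sub>v a + \<beta> \<cdot>\<^sub>v b + \<gamma> \<cdot>\<^sub>v c = 0\<^sub>v 4 \<longrightarrow> \<alpha> = 0 \<and> \<beta> = 0 \<and> \<gamma> = 0)"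

definition N_mat :: "'k::field mpol vec \<Rightarrow> 'k mpol mat" where
  "N_mat g = mat_of_rows_list 4
     [[Const (1/2) * g $ 0, - (Const (1/2) * g $ 1), - (Const (1/2) * g $ 2), - (Const (1/2) * g $ 3)],
      [0, g $ 0, 0, 0],
      [0, 0, g $ 0, 0],
      [0, 0, 0, g $ 0]]"

definition moving_plane :: "'k::field mpol vec \<Rightarrow> 'k mpol" where
  "moving_plane A = vec_of_list [Var W, Var X, Var Y, Var Z] \<bullet> A"

end

theory Submission
  imports Defs "Berlekamp_Zassenhaus.Unique_Factorization_Poly"
begin

text \<open>
  If \<open>\<a>\<close> belongs to a syzygy basis, then \<open>\<x>\<A>\<close> is linear in \<open>w, x, y, z\<close> with coprime
  coefficients, hence prime. It cannot divide \<open>\<x>\<C>\<close>, since \<open>\<a>\<close> and \<open>\<c>\<close> are not proportional,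
  so \<open>Res\<^sub>s\<^sub>u(\<x>\<A>, \<x>\<C>)\<close> is nonzero; it is homogeneous in \<open>t, v\<close>, and so is its factor \<open>F\<^sub>0\<close>. The same
  holds for \<open>F\<^sub>1\<close>. Two forms in \<open>t, v\<close>, the first prime and not dividing the second, have a
  nonzero resultant: a vector in the left kernel of their Sylvester matrix is a relation
  \<open>P F\<^sub>0 + Q F\<^sub>1 = 0\<close> in which \<open>Q\<close> has smaller degree than \<open>F\<^sub>0\<close>.

  After substituting \<open>\<h>\<close> for \<open>w, x, y, z\<close>, the forms \<open>F\<^sub>0\<close> and \<open>F\<^sub>1\<close> acquire the common zero \<open>(t, v)\<close>,
  so their resultant vanishes on the image of \<open>\<h>\<close>, and a Nullstellensatz for hypersurfaces makes it
  a multiple of \<open>F\<close>. The exception is the case where \<open>F\<^sub>0\<close> and \<open>F\<^sub>1\<close> do not involve \<open>t, v\<close> and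
  the empty determinant is \<open>1\<close>: then \<open>F\<close> divides both \<open>F\<^sub>0\<close> and \<open>F\<^sub>1\<close>, which would make them
  associates.
\<close>

abbreviation "lookup \<equiv> Poly_Mapping.lookup"
abbreviation "keys \<equiv> Poly_Mapping.keys"
abbreviation "single \<equiv> Poly_Mapping.single"

lemma UNIV_var: "UNIV = {S,U,T,V,W,X,Y,Z}"
  using var.exhaust by blast

lemma finite_var [simp]: "finite (I :: var set)"
  by (rule finite_subset[OF subset_UNIV]) (simp add: UNIV_var)

subsection \<open>Gradings\<close>

lemma mon_deg_add: "mon_deg I (m + m') = mon_deg I m + mon_deg I m'"
  by (simp add: mon_deg_def lookup_add sum.distrib)

lemma mon_deg_single: "mon_deg I (single i k) = (if i \<in> I then k else 0)"
  by (simp add: mon_deg_def lookup_single when_def)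

text \<open>The parts of maximal weight in \<open>p\<close> and \<open>q\<close> have a nonzero
  product because the ring is a domain, and all other products of terms have smaller weight, so
  nothing can cancel it. The weight takes integer values so that a negated degree is allowed as
  well.\<close>

lemma keys_mult_max:
  fixes p q :: "'k::idom mpol" and w :: "monomial \<Rightarrow> int"
  assumes w: "\<And>m m'. w (m + m') = w m + w m'"
    and p: "mp \<in> keys p" "\<And>m. m \<in> keys p \<Longrightarrow> w m \<le> w mp"
    and q: "mq \<in> keys q" "\<And>m. m \<in> keys q \<Longrightarrow> w m \<le> w mq"
  shows "\<exists>m\<in>keys (p * q). w m = w mp + w mq"
proof -
  \<comment> \<open>\<open>top r a\<close> is the part of \<open>r\<close> of weight
    \<open>a\<close>. What remains of \<open>p\<close> and \<open>q\<close> after removing the top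
    part, \<open>p'\<close> and \<open>q'\<close>, has strictly smaller weight.\<close>
  define top where "top r a = Poly_Mapping.mapp (\<lambda>m c. if w m = a then c else 0) r" for r :: "'k mpol" and a
  have lookup_top: "lookup (top r a) m = (if w m = a then lookup r m else 0)" for r a m
    by (auto simp: top_def lookup_mapp when_def in_keys_iff)
  define p' q' where "p' = p - top p (w mp)" and "q' = q - top q (w mq)"
  have less_p: "w m < w mp" if "m \<in> keys p'" for m
  proof -
    have "m \<in> keys p \<and> w m \<noteq> w mp"
      using that by (auto simp: p'_def in_keys_iff lookup_minus lookup_top split: if_splits)
    then show ?thesis using p(2)[of m] by simp
  qed
  have less_q: "w m < w mq" if "m \<in> keys q'" for m
  proof -
    have "m \<in> keys q \<and> w m \<noteq> w mq"
      using that by (auto simp: q'_def in_keys_iff lookup_minus lookup_top split: if_splits)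
    then show ?thesis using q(2)[of m] by simp
  qed
  have eq_top: "w m = a" if "m \<in> keys (top r a)" for m r a
    using that by (auto simp: in_keys_iff lookup_top split: if_splits)
  have "lookup (top p (w mp)) mp \<noteq> 0" "lookup (top q (w mq)) mq \<noteq> 0"
    using p(1) q(1) by (auto simp: lookup_top in_keys_iff)
  then have "top p (w mp) \<noteq> 0" "top q (w mq) \<noteq> 0"
    by auto
  then have "top p (w mp) * top q (w mq) \<noteq> 0"
    by simp
  then obtain m where m: "m \<in> keys (top p (w mp) * top q (w mq))"
    by (metis all_not_in_conv keys_eq_empty)
  then obtain a b where "m = a + b" "a \<in> keys (top p (w mp))" "b \<in> keys (top q (w mq))"
    using keys_mult by blast
  then have wm: "w m = w mp + w mq"
    using eq_top w by metis
  have "m \<notin> keys (top p (w mp) * q' + p' * q)"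
  proof
    assume "m \<in> keys (top p (w mp) * q' + p' * q)"
    then have "m \<in> keys (top p (w mp) * q') \<or> m \<in> keys (p' * q)"
      using Poly_Mapping.keys_add[of "top p (w mp) * q'" "p' * q"] by auto
    then show False
    proof
      assume "m \<in> keys (top p (w mp) * q')"
      then obtain a b where "m = a + b" "a \<in> keys (top p (w mp))" "b \<in> keys q'"
        using keys_mult by blast
      then show False using wm eq_top[of a p] less_q[of b] w[of a b] by simp
    next
      assume "m \<in> keys (p' * q)"
      then obtain a b where "m = a + b" "a \<in> keys p'" "b \<in> keys q"
        using keys_mult by blast
      then show False using wm q(2)[of b] less_p[of a] w[of a b] by simp
    qed
  qed
  moreover have "p * q = top p (w mp) * top q (w mq) + (top p (w mp) * q' + p' * q)"
    by (simp add: p'_def q'_def algebra_simps)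
  ultimately have "m \<in> keys (p * q)"
    using m by (simp add: in_keys_iff lookup_add)
  with wm show ?thesis by blast
qed

text \<open>Both the largest and the smallest degrees of terms add up under multiplication. They
  coincide for the product, so they coincide for each factor.\<close>

lemma homog_in_factor:
  fixes p q :: "'k::idom mpol"
  assumes hom: "homog_in I k (p * q)" and nz: "p * q \<noteq> 0"
  obtains i j where "i + j = k" "homog_in I i p" "homog_in I j q"
proof -
  have fin: "finite (keys p)" "finite (keys q)" by auto
  have ne: "keys p \<noteq> {}" "keys q \<noteq> {}" using nz by auto
  define d where "d = mon_deg I"
  have dadd: "d (m + m') = d m + d m'" for m m' by (simp add: d_def mon_deg_add)
  have ex_max: "\<exists>x\<in>A. \<forall>y\<in>A. d y \<le> d x" if "finite A" "A \<noteq> {}" for A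
    using Max_in[of "d ` A"] Max_ge[of "d ` A"] that by fastforce
  have ex_min: "\<exists>x\<in>A. \<forall>y\<in>A. d x \<le> d y" if "finite A" "A \<noteq> {}" for A
    using Min_in[of "d ` A"] Min_le[of "d ` A"] that by fastforce
  obtain p1 where p1: "p1 \<in> keys p" "\<And>m. m \<in> keys p \<Longrightarrow> d m \<le> d p1"
    using ex_max[OF fin(1) ne(1)] by auto
  obtain q1 where q1: "q1 \<in> keys q" "\<And>m. m \<in> keys q \<Longrightarrow> d m \<le> d q1"
    using ex_max[OF fin(2) ne(2)] by auto
  obtain p0 where p0: "p0 \<in> keys p" "\<And>m. m \<in> keys p \<Longrightarrow> d p0 \<le> d m"
    using ex_min[OF fin(1) ne(1)] by auto
  obtain q0 where q0: "q0 \<in> keys q" "\<And>m. m \<in> keys q \<Longrightarrow> d q0 \<le> d m"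
    using ex_min[OF fin(2) ne(2)] by auto
  have "\<exists>m\<in>keys (p * q). int (d m) = int (d p1) + int (d q1)"
    by (rule keys_mult_max) (use p1 q1 in \<open>auto simp: dadd\<close>)
  then have 1: "d p1 + d q1 = k"
    using hom by (auto simp: homog_in_def d_def)
  \<comment> \<open>Negating the weight turns the statement about maxima into the one about
    minima.\<close>
  have "\<exists>m\<in>keys (p * q). - int (d m) = - int (d p0) + - int (d q0)"
    by (rule keys_mult_max) (use p0 q0 in \<open>auto simp: dadd\<close>)
  then have 2: "d p0 + d q0 = k"
    using hom unfolding homog_in_def d_def by force
  have le: "d p0 \<le> d p1" "d q0 \<le> d q1"
    using p0 p1 q0 q1 by auto
  then have "d p0 = d p1" "d q0 = d q1" using 1 2 by auto
  then have "homog_in I (d p1) p" "homog_in I (d q1) q"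
    using p0 p1 q0 q1 unfolding homog_in_def d_def by (metis le_antisym)+
  with 1 that show thesis by blast
qed

section \<open>Homogeneity under the ring operations\<close>

lemma homog_in_0 [simp]: "homog_in I k 0"
  by (simp add: homog_in_def)

lemma homog_in_unique: "homog_in I i p \<Longrightarrow> homog_in I j p \<Longrightarrow> p \<noteq> 0 \<Longrightarrow> i = j"
  unfolding homog_in_def by (metis equals0I keys_eq_empty)

lemma homog_in_add: "homog_in I k p \<Longrightarrow> homog_in I k q \<Longrightarrow> homog_in I k (p + q)"
  unfolding homog_in_def using Poly_Mapping.keys_add[of p q] by blast

lemma homog_in_uminus: "homog_in I k p \<Longrightarrow> homog_in I k (- p)"
  for p :: "'k::comm_ring_1 mpol"
  by (simp add: homog_in_def in_keys_iff)

lemma homog_in_diff: "homog_in I k p \<Longrightarrow> homog_in I k q \<Longrightarrow> homog_in I k (p - q)"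
  for p q :: "'k::comm_ring_1 mpol"
  using homog_in_add[of I k p "- q"] by (simp add: homog_in_uminus)

lemma homog_in_sum: "(\<And>i. i \<in> A \<Longrightarrow> homog_in I k (p i)) \<Longrightarrow> homog_in I k (\<Sum>i\<in>A. p i)"
  by (induction A rule: infinite_finite_induct) (auto intro: homog_in_add)

lemma homog_in_mult: "homog_in I i p \<Longrightarrow> homog_in I j q \<Longrightarrow> homog_in I (i + j) (p * q)"
  unfolding homog_in_def using keys_mult[of p q] mon_deg_add by fastforce

lemma homog_in_Const [simp]: "homog_in I 0 (Const c)"
  by (simp add: homog_in_def Const_def mon_deg_def)

lemma Const_1: "Const 1 = 1"
  by (simp add: Const_def)

lemma homog_in_1 [simp]: "homog_in I 0 (1 :: 'k::comm_semiring_1 mpol)"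
  using homog_in_Const[of I "1::'k"] by (simp add: Const_1)

lemma homog_in_Var: "homog_in I (if i \<in> I then 1 else 0) (Var i)"
  by (simp add: homog_in_def Var_def mon_deg_single)

lemma homog_in_prod:
  fixes p :: "'a \<Rightarrow> 'k::comm_semiring_1 mpol"
  shows "(\<And>i. i \<in> A \<Longrightarrow> homog_in I (k i) (p i)) \<Longrightarrow> homog_in I (\<Sum>i\<in>A. k i) (\<Prod>i\<in>A. p i)"
  by (induction A rule: infinite_finite_induct) (auto intro: homog_in_mult)

lemma homog_in_power:
  fixes p :: "'k::comm_semiring_1 mpol"
  shows "homog_in I k p \<Longrightarrow> homog_in I (n * k) (p ^ n)"
  by (induction n) (auto intro: homog_in_mult)

lemma homog_in_unit:
  fixes e :: "'k::idom mpol"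
  assumes "e dvd 1"
  shows "homog_in I 0 e"
proof -
  obtain r where r: "1 = e * r" using assms ..
  have "homog_in I 0 (e * r)" "e * r \<noteq> 0" unfolding r[symmetric] by simp_all
  then obtain i j where "i + j = 0" "homog_in I i e" "homog_in I j r"
    by (rule homog_in_factor)
  then show ?thesis by simp
qed

lemma Var_nonzero: "(Var i :: 'k::zero_neq_one mpol) \<noteq> 0"
  unfolding Var_def by (metis lookup_single_eq lookup_zero zero_neq_one)

section \<open>Subrings of polynomials in selected variables\<close>

lemma mon_deg_eq_0_iff: "mon_deg I m = 0 \<longleftrightarrow> keys m \<inter> I = {}"
  by (auto simp: mon_deg_def in_keys_iff)

text \<open>Membership in \<open>polys J\<close> is homogeneity of degree 0 in the remaining
  variables, so closure properties, and closure under taking factors, are inherited from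
  \<open>homog_in\<close>.\<close>

lemma polys_iff_homog: "p \<in> polys J \<longleftrightarrow> homog_in (- J) 0 p"
  unfolding polys_def homog_in_def mon_deg_eq_0_iff by auto

lemma homog_in_polys: "p \<in> polys J \<Longrightarrow> I \<inter> J = {} \<Longrightarrow> homog_in I 0 p"
  unfolding polys_def homog_in_def mon_deg_eq_0_iff by auto

lemma polys_mono: "p \<in> polys J \<Longrightarrow> J \<subseteq> J' \<Longrightarrow> p \<in> polys J'"
  unfolding polys_def by blast

lemma polys_inter: "p \<in> polys J \<Longrightarrow> p \<in> polys J' \<Longrightarrow> p \<in> polys (J \<inter> J')"
  unfolding polys_def by blast

lemma polysD: "p \<in> polys J \<Longrightarrow> m \<in> keys p \<Longrightarrow> i \<in> keys m \<Longrightarrow> i \<in> J"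
  unfolding polys_def by blast

lemma polys_UNIV [simp]: "p \<in> polys UNIV"
  by (simp add: polys_def)

lemma polys_0 [simp]: "0 \<in> polys J" and polys_Const [simp]: "Const c \<in> polys J"
  by (simp_all add: polys_iff_homog)

lemma polys_1 [simp]: "(1 :: 'k::comm_semiring_1 mpol) \<in> polys J"
  by (simp add: polys_iff_homog)

lemma polys_Var: "i \<in> J \<Longrightarrow> Var i \<in> polys J"
  using homog_in_Var[of "- J" i] by (simp add: polys_iff_homog)

lemma polys_uminus: "p \<in> polys J \<Longrightarrow> - p \<in> polys J" for p :: "'k::comm_ring_1 mpol"
  by (simp add: polys_iff_homog homog_in_uminus)

lemma polys_diff: "p \<in> polys J \<Longrightarrow> q \<in> polys J \<Longrightarrow> p - q \<in> polys J"
  for p q :: "'k::comm_ring_1 mpol"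
  by (simp add: polys_iff_homog homog_in_diff)

lemma polys_sum: "(\<And>i. i \<in> A \<Longrightarrow> p i \<in> polys J) \<Longrightarrow> (\<Sum>i\<in>A. p i) \<in> polys J"
  by (simp add: polys_iff_homog homog_in_sum)

lemma polys_mult: "p \<in> polys J \<Longrightarrow> q \<in> polys J \<Longrightarrow> p * q \<in> polys J"
  using homog_in_mult[of "- J" 0 p 0 q] by (simp add: polys_iff_homog)

lemma polys_power: "p \<in> polys J \<Longrightarrow> p ^ n \<in> polys J" for p :: "'k::comm_semiring_1 mpol"
  using homog_in_power[of "- J" 0 p n] by (simp add: polys_iff_homog)

lemma polys_factor:
  fixes p q :: "'k::idom mpol"
  assumes "p * q \<in> polys J" "p * q \<noteq> 0"
  shows "p \<in> polys J" "q \<in> polys J"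
  using homog_in_factor[of "- J" 0 p q] assms by (auto simp: polys_iff_homog)

lemma mpol_expand: "p = (\<Sum>m\<in>keys p. single m (lookup p m))"
  by (rule poly_mapping_eqI)
    (auto simp: lookup_sum lookup_single when_def in_keys_iff)

subsection \<open>Coefficients with respect to one variable\<close>

text \<open>The one-variable analogue of \<open>coeff_at\<close>: the coefficient of the
  \<open>k\<close>-th power of the variable \<open>z\<close>, kept as an element of the same big
  ring.\<close>

definition cf :: "var \<Rightarrow> nat \<Rightarrow> 'k::comm_monoid_add mpol \<Rightarrow> 'k mpol" where
  "cf z k p = (\<Sum>m | m \<in> keys p \<and> lookup m z = k. single (m - single z k) (lookup p m))"

text \<open>Exponents are subtracted with truncation at 0; the hypothesis makes the subtraction
  exact, so it can be undone by addition.\<close>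

lemma minus_single_eq_iff:
  fixes m n :: monomial
  assumes "lookup m z = k"
  shows "m - single z k = n \<longleftrightarrow> lookup n z = 0 \<and> m = n + single z k"
proof -
  have "m - single z k + single z k = m"
    by (rule poly_mapping_eqI) (use assms in \<open>auto simp: lookup_add lookup_minus lookup_single when_def\<close>)
  moreover have "lookup (m - single z k) z = 0"
    using assms by (simp add: lookup_minus)
  ultimately show ?thesis
    by auto
qed

lemma lookup_cf: "lookup (cf z k p) n = (if lookup n z = 0 then lookup p (n + single z k) else 0)"
proof -
  have "lookup (cf z k p) n = (\<Sum>m | m \<in> keys p \<and> lookup m z = k. if m - single z k = n then lookup p m else 0)"
    by (simp add: cf_def lookup_sum lookup_single when_def)
  also have "\<dots> = (\<Sum>m | m \<in> keys p \<and> lookup m z = k.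
      if m = n + single z k then (if lookup n z = 0 then lookup p (n + single z k) else 0) else 0)"
    by (rule sum.cong) (auto simp: minus_single_eq_iff)
  also have "\<dots> = (if lookup n z = 0 then lookup p (n + single z k) else 0)"
    by (auto simp: lookup_add in_keys_iff)
  finally show ?thesis .
qed

text \<open>Extracting from two variables is extracting twice from one, so everything about
  \<open>coeff_at\<close> reduces to \<open>cf\<close>.\<close>

lemma coeff_at_eq_cf:
  assumes "a \<noteq> b"
  shows "coeff_at a b i j p = cf a i (cf b j p)"
proof (rule poly_mapping_eqI)
  fix n
  have iff: "m - single a i - single b j = n \<longleftrightarrow>
      lookup n a = 0 \<and> lookup n b = 0 \<and> m = n + single a i + single b j"
    if "lookup m a = i" "lookup m b = j" for m :: monomial
  proof -
    have "m - single a i - single b j = n \<longleftrightarrow> lookup n b = 0 \<and> m - single a i = n + single b j"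
      by (rule minus_single_eq_iff) (use that assms in \<open>simp add: lookup_minus lookup_single\<close>)
    also have "m - single a i = n + single b j \<longleftrightarrow>
        lookup (n + single b j) a = 0 \<and> m = n + single b j + single a i"
      by (rule minus_single_eq_iff) (fact that)
    finally show ?thesis
      using assms by (auto simp: lookup_add lookup_single ac_simps)
  qed
  have "lookup (coeff_at a b i j p) n = (\<Sum>m | m \<in> keys p \<and> lookup m a = i \<and> lookup m b = j.
      if m - single a i - single b j = n then lookup p m else 0)"
    by (simp add: coeff_at_def lookup_sum lookup_single when_def)
  also have "\<dots> = (\<Sum>m | m \<in> keys p \<and> lookup m a = i \<and> lookup m b = j.
      if m = n + single a i + single b j then
        (if lookup n a = 0 \<and> lookup n b = 0 then lookup p (n + single a i + single b j) else 0) else 0)"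
    by (rule sum.cong) (auto simp: iff)
  also have "\<dots> = (if lookup n a = 0 \<and> lookup n b = 0 then lookup p (n + single a i + single b j) else 0)"
    using assms by (auto simp: lookup_add in_keys_iff lookup_single)
  also have "\<dots> = lookup (cf a i (cf b j p)) n"
    using assms by (auto simp: lookup_cf lookup_add lookup_single)
  finally show "lookup (coeff_at a b i j p) n = lookup (cf a i (cf b j p)) n" .
qed

lemma cf_add: "cf z k (p + q) = cf z k p + cf z k q"
  by (rule poly_mapping_eqI) (simp add: lookup_cf lookup_add)

lemma cf_0 [simp]: "cf z k 0 = 0"
  by (simp add: cf_def)

lemma cf_sum: "cf z k (\<Sum>i\<in>A. p i) = (\<Sum>i\<in>A. cf z k (p i))"
  by (induction A rule: infinite_finite_induct) (auto simp: cf_add)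

lemma cf_polys: "p \<in> polys J \<Longrightarrow> cf z k p \<in> polys (J - {z})"
proof -
  assume p: "p \<in> polys J"
  have "x \<in> J - {z}" if n: "n \<in> keys (cf z k p)" and x: "x \<in> keys n" for n x
  proof -
    have "lookup n z = 0" "n + single z k \<in> keys p"
      using n by (auto simp: in_keys_iff lookup_cf split: if_splits)
    moreover have "x \<in> keys (n + single z k)"
      using x by (simp add: in_keys_iff lookup_add)
    ultimately have "x \<in> J"
      using p unfolding polys_def by blast
    with x \<open>lookup n z = 0\<close> show ?thesis
      by (auto simp: in_keys_iff)
  qed
  then show ?thesis by (auto simp: polys_def)
qed

lemma cf_nonzero:
  assumes "p \<noteq> 0"
  obtains k where "cf z k p \<noteq> 0"
proof -
  obtain m where m: "lookup p m \<noteq> 0"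
    using assms by (auto simp: poly_mapping_eq_iff fun_eq_iff)
  have "m = (m - single z (lookup m z)) + single z (lookup m z)"
    using minus_single_eq_iff by blast
  with m have "lookup (cf z (lookup m z) p) (m - single z (lookup m z)) \<noteq> 0"
    by (simp add: lookup_cf lookup_minus)
  then show thesis
    using that[of "lookup m z"] by (metis lookup_zero)
qed

lemma Var_power: "Var z ^ k = (single (single z k) 1 :: 'k::comm_semiring_1 mpol)"
  by (induction k) (auto simp: Var_def mult_single single_add[symmetric])

lemma cf_single: "cf z k (single m c) = (if lookup m z = k then single (m - single z k) c else 0)"
proof -
  have "{m'. m' \<in> keys (single m c) \<and> lookup m' z = k} = (if c \<noteq> 0 \<and> lookup m z = k then {m} else {})"
    by auto
  then show ?thesis by (auto simp: cf_def)
qed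

text \<open>Coefficient extraction is linear over the polynomials free of \<open>z\<close>; by
  bilinearity this is checked on pairs of monomials.\<close>

lemma cf_mult_left:
  fixes p q :: "'k::comm_semiring_1 mpol"
  assumes p: "p \<in> polys (- {z})"
  shows "cf z k (p * q) = p * cf z k q"
proof -
  have *: "cf z k (single a c * single m d) = single a c * cf z k (single m d)"
    if "lookup a z = 0" for a m and c d :: 'k
  proof (cases "lookup m z = k")
    case True
    have "a + m - single z k = a + (m - single z k)"
      by (rule poly_mapping_eqI)
        (use True in \<open>auto simp: lookup_add lookup_minus lookup_single when_def\<close>)
    with that True show ?thesis
      by (simp add: mult_single cf_single lookup_add)
  qed (use that in \<open>simp add: mult_single cf_single lookup_add\<close>)
  have a: "lookup a z = 0" if "a \<in> keys p" for a
    using p that by (auto simp: polys_def in_keys_iff)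
  have "cf z k (p * q) = cf z k (\<Sum>a\<in>keys p. \<Sum>m\<in>keys q. single a (lookup p a) * single m (lookup q m))"
    by (subst mpol_expand[of p], subst mpol_expand[of q]) (simp add: sum_product)
  also have "\<dots> = (\<Sum>a\<in>keys p. \<Sum>m\<in>keys q. single a (lookup p a) * cf z k (single m (lookup q m)))"
    by (simp add: cf_sum * a)
  also have "\<dots> = (\<Sum>a\<in>keys p. single a (lookup p a)) * cf z k (\<Sum>m\<in>keys q. single m (lookup q m))"
    by (simp add: cf_sum sum_product)
  finally show ?thesis
    by (simp flip: mpol_expand)
qed

lemma cf_mult_Var_power:
  fixes p :: "'k::comm_semiring_1 mpol"
  assumes "p \<in> polys (- {z})"
  shows "cf z k (p * Var z ^ j) = (if k = j then p else 0)"
proof -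
  have "cf z k (Var z ^ j) = (if k = j then 1 else 0 :: 'k mpol)"
    by (simp add: Var_power cf_single)
  then show ?thesis
    by (simp add: cf_mult_left[OF assms])
qed

lemma cf_times_Var_power:
  fixes p :: "'k::comm_semiring_1 mpol"
  shows "cf z k p * Var z ^ k = (\<Sum>m | m \<in> keys p \<and> lookup m z = k. single m (lookup p m))"
proof -
  have "m - single z k + single z k = m" if "lookup m z = k" for m
    using minus_single_eq_iff[OF that, of "m - single z k"] by simp
  then show ?thesis
    unfolding cf_def sum_distrib_right by (intro sum.cong) (auto simp: Var_power mult_single)
qed

lemma mpol_expand_var:
  fixes p :: "'k::comm_semiring_1 mpol"
  assumes "\<And>m. m \<in> keys p \<Longrightarrow> lookup m z \<le> N"
  shows "p = (\<Sum>k\<le>N. cf z k p * Var z ^ k)"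
proof -
  have "(\<Sum>k\<in>{..N}. cf z k p * Var z ^ k) =
      (\<Sum>k\<in>{..N}. \<Sum>m\<in>{m \<in> keys p. lookup m z = k}. single m (lookup p m))"
    by (simp add: cf_times_Var_power)
  also have "\<dots> = (\<Sum>m\<in>keys p. single m (lookup p m))"
    by (rule sum.group) (use assms in auto)
  finally show ?thesis
    by (simp flip: mpol_expand)
qed

text \<open>In a form of degree \<open>d\<close> the exponent of \<open>a\<close> determines that of
  \<open>b\<close>. Hence each coefficient in the expansion by powers of \<open>a\<close> alone is
  already a multiple of a single power of \<open>b\<close>.\<close>

lemma mpol_expand_homog:
  fixes p :: "'k::comm_semiring_1 mpol"
  assumes "a \<noteq> b" "homog_in {a,b} d p"
  shows "p = (\<Sum>k\<le>d. coeff_at a b k (d - k) p * Var a ^ k * Var b ^ (d - k))"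
proof -
  have deg: "lookup m a + lookup m b = d" if "m \<in> keys p" for m
    using assms that by (auto simp: homog_in_def mon_deg_def)
  have "coeff_at a b k (d - k) p * Var a ^ k * Var b ^ (d - k) = cf a k p * Var a ^ k" if "k \<le> d" for k
  proof -
    have lk: "lookup m b = d - k" if "m \<in> keys (cf a k p)" for m
      using that deg[of "m + single a k"] assms
      by (auto simp: in_keys_iff lookup_cf lookup_add lookup_single split: if_splits)
    have "cf b (d - k) (cf a k p) * Var b ^ (d - k) =
        (\<Sum>m | m \<in> keys (cf a k p) \<and> lookup m b = d - k. single m (lookup (cf a k p) m))"
      by (rule cf_times_Var_power)
    also have "\<dots> = (\<Sum>m\<in>keys (cf a k p). single m (lookup (cf a k p) m))"
      by (rule sum.cong) (auto simp: lk)
    also have "\<dots> = cf a k p"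
      by (simp flip: mpol_expand)
    finally have "cf b (d - k) (cf a k p) * Var b ^ (d - k) = cf a k p" .
    moreover have "coeff_at a b k (d - k) p = cf b (d - k) (cf a k p)"
      by (rule poly_mapping_eqI)
        (use assms in \<open>simp add: coeff_at_eq_cf lookup_cf lookup_add lookup_single ac_simps\<close>)
    moreover have "coeff_at a b k (d - k) p * Var a ^ k * Var b ^ (d - k) =
        coeff_at a b k (d - k) p * Var b ^ (d - k) * Var a ^ k"
      by (simp add: ac_simps)
    ultimately show ?thesis by simp
  qed
  then have "(\<Sum>k\<le>d. coeff_at a b k (d - k) p * Var a ^ k * Var b ^ (d - k)) = (\<Sum>k\<le>d. cf a k p * Var a ^ k)"
    by simp
  moreover have "p = (\<Sum>k\<le>d. cf a k p * Var a ^ k)"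
    by (rule mpol_expand_var) (metis deg le_add1)
  ultimately show ?thesis by simp
qed

subsection \<open>Evaluation\<close>

text \<open>The product runs over all variables, absent ones contributing 1, so that
  multiplicativity needs no comparison of supports.\<close>

definition mon_eval :: "(var \<Rightarrow> 'b::comm_ring_1) \<Rightarrow> monomial \<Rightarrow> 'b" where
  "mon_eval \<sigma> m = (\<Prod>i\<in>UNIV. \<sigma> i ^ lookup m i)"

lemma mon_eval_add: "mon_eval \<sigma> (m + n) = mon_eval \<sigma> m * mon_eval \<sigma> n"
  by (simp add: mon_eval_def lookup_add power_add prod.distrib)

lemma mon_eval_keys: "(\<Prod>i\<in>keys m. \<sigma> i ^ lookup m i) = mon_eval \<sigma> m"
  unfolding mon_eval_def by (rule prod.mono_neutral_left) (auto simp: in_keys_iff)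

lemma eval_mpol_eq: "eval_mpol c \<sigma> p = (\<Sum>m\<in>keys p. c (lookup p m) * mon_eval \<sigma> m)"
  by (simp add: eval_mpol_def mon_eval_keys)

text \<open>Terms can cancel in a sum, so additivity of evaluation is proved by summing over a
  common superset of the supports.\<close>

lemma eval_mpol_superset:
  assumes "c 0 = 0" "finite A" "keys p \<subseteq> A"
  shows "eval_mpol c \<sigma> p = (\<Sum>m\<in>A. c (lookup p m) * mon_eval \<sigma> m)"
  unfolding eval_mpol_eq by (rule sum.mono_neutral_left) (use assms in \<open>auto simp: in_keys_iff\<close>)

lemma eval_mpol_single:
  assumes "c 0 = 0"
  shows "eval_mpol c \<sigma> (single m a) = c a * mon_eval \<sigma> m"
  using eval_mpol_superset[of c "{m}" "single m a" \<sigma>] assms by simp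

lemma comm_ring_hom_eval:
  fixes c :: "'k::comm_ring_1 \<Rightarrow> 'b::comm_ring_1"
  assumes "comm_ring_hom c"
  shows "comm_ring_hom (eval_mpol c \<sigma>)"
proof -
  interpret c: comm_ring_hom c by fact
  have add: "eval_mpol c \<sigma> (p + q) = eval_mpol c \<sigma> p + eval_mpol c \<sigma> q" for p q
    using Poly_Mapping.keys_add[of p q]
    by (simp add: eval_mpol_superset[of c "keys p \<union> keys q"] lookup_add c.hom_add
        sum.distrib distrib_right)
  have sum: "eval_mpol c \<sigma> (\<Sum>i\<in>A. p i) = (\<Sum>i\<in>A. eval_mpol c \<sigma> (p i))"
    for A and p :: "monomial \<Rightarrow> 'k mpol"
    by (induction A rule: infinite_finite_induct) (simp_all add: add, simp_all add: eval_mpol_def)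
  have "eval_mpol c \<sigma> (p * q) = eval_mpol c \<sigma> p * eval_mpol c \<sigma> q" for p q
  proof -
    have "eval_mpol c \<sigma> (p * q) =
        eval_mpol c \<sigma> (\<Sum>a\<in>keys p. \<Sum>m\<in>keys q. single a (lookup p a) * single m (lookup q m))"
      by (subst mpol_expand[of p], subst mpol_expand[of q]) (simp add: sum_product)
    also have "\<dots> = (\<Sum>a\<in>keys p. \<Sum>m\<in>keys q.
        (c (lookup p a) * mon_eval \<sigma> a) * (c (lookup q m) * mon_eval \<sigma> m))"
      by (simp add: sum mult_single eval_mpol_single mon_eval_add c.hom_mult ac_simps)
    also have "\<dots> = eval_mpol c \<sigma> p * eval_mpol c \<sigma> q"
      by (simp add: eval_mpol_eq sum_product)
    finally show ?thesis .
  qed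
  with add show ?thesis
    by unfold_locales (auto simp: eval_mpol_def)
qed

lemma eval_mpol_Const [simp]: "c 0 = 0 \<Longrightarrow> eval_mpol c \<sigma> (Const a) = c a"
  by (simp add: Const_def eval_mpol_single mon_eval_def)

lemma eval_mpol_Var [simp]:
  assumes "comm_ring_hom c"
  shows "eval_mpol c \<sigma> (Var i) = \<sigma> i"
proof -
  interpret comm_ring_hom c by fact
  have "mon_eval \<sigma> (single i 1) = (\<Prod>j\<in>UNIV. if j = i then \<sigma> i else 1)"
    unfolding mon_eval_def by (rule prod.cong) (auto simp: lookup_single when_def)
  then show ?thesis
    by (simp add: Var_def eval_mpol_single)
qed

text \<open>Composes evaluations: this is how a substitution followed by a specialization becomes a
  single evaluation.\<close>

lemma (in comm_ring_hom) hom_eval_mpol: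
  "hom (eval_mpol c \<sigma> p) = eval_mpol (\<lambda>a. hom (c a)) (\<lambda>i. hom (\<sigma> i)) p"
  by (simp add: eval_mpol_def hom_distribs)

lemma eval_mpol_cong:
  assumes "p \<in> polys J" "\<And>i. i \<in> J \<Longrightarrow> \<sigma> i = \<tau> i"
  shows "eval_mpol c \<sigma> p = eval_mpol c \<tau> p"
proof -
  have "(\<Prod>i\<in>keys m. \<sigma> i ^ lookup m i) = (\<Prod>i\<in>keys m. \<tau> i ^ lookup m i)" if "m \<in> keys p" for m
    by (rule prod.cong) (use assms polysD[OF assms(1) that] in auto)
  then show ?thesis by (simp add: eval_mpol_def)
qed

lemma comm_ring_hom_Const: "comm_ring_hom Const"
  by unfold_locales (simp_all add: Const_def single_add mult_single)

lemma comm_ring_hom_id: "comm_ring_hom id"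
  by unfold_locales simp_all

lemma mon_eval_Var: "mon_eval Var m = (single m 1 :: 'k::comm_ring_1 mpol)"
proof -
  have "(\<Prod>i\<in>I. single (single i (lookup m i)) 1) =
      (single (\<Sum>i\<in>I. single i (lookup m i)) 1 :: 'k mpol)" for I
    by (induction I rule: infinite_finite_induct) (auto simp: mult_single)
  moreover have "(\<Sum>i\<in>UNIV. single i (lookup m i)) = m"
    by (rule poly_mapping_eqI) (simp add: lookup_sum lookup_single when_def)
  ultimately show ?thesis
    by (simp add: mon_eval_def Var_power)
qed

lemma eval_mpol_Const_Var: "eval_mpol Const Var p = p"
  for p :: "'k::comm_ring_1 mpol"
  by (subst (2) mpol_expand[of p]) (simp add: eval_mpol_eq mon_eval_Var Const_def mult_single)

lemma eval_mpol_homog: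
  fixes p :: "'k::comm_ring_1 mpol" and \<sigma> :: "var \<Rightarrow> 'l::comm_ring_1 mpol"
  assumes p: "homog_in I d p" and "\<And>a. homog_in J 0 (c a)"
    and \<sigma>: "\<And>i. homog_in J (if i \<in> I then 1 else 0) (\<sigma> i)"
  shows "homog_in J d (eval_mpol c \<sigma> p)"
  unfolding eval_mpol_eq
proof (rule homog_in_sum)
  fix m assume m: "m \<in> keys p"
  have "homog_in J (\<Sum>i\<in>UNIV. lookup m i * (if i \<in> I then 1 else 0)) (mon_eval \<sigma> m)"
    unfolding mon_eval_def by (intro homog_in_prod homog_in_power \<sigma>)
  moreover have "(\<Sum>i\<in>UNIV. lookup m i * (if i \<in> I then 1 else 0)) = (\<Sum>i\<in>I. lookup m i)"
    by (rule sum.mono_neutral_cong_right) auto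
  moreover have "(\<Sum>i\<in>I. lookup m i) = d"
    using p m by (auto simp: homog_in_def mon_deg_def)
  ultimately have "homog_in J (0 + d) (c (lookup p m) * mon_eval \<sigma> m)"
    by (intro homog_in_mult assms) simp
  then show "homog_in J d (c (lookup p m) * mon_eval \<sigma> m)" by simp
qed

lemma eval_mpol_scale:
  fixes p :: "'k::comm_ring_1 mpol"
  assumes p: "homog_in I d p" "p \<in> polys I"
  shows "eval_mpol id (\<lambda>i. c * \<sigma> i) p = c ^ d * eval_mpol id \<sigma> p"
proof -
  have "mon_eval (\<lambda>i. c * \<sigma> i) m = c ^ d * mon_eval \<sigma> m" if "m \<in> keys p" for m
  proof -
    have "(\<Sum>i\<in>UNIV. lookup m i) = (\<Sum>i\<in>I. lookup m i)"
      by (rule sum.mono_neutral_right) (use polysD[OF p(2) that] in \<open>auto simp: in_keys_iff\<close>)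
    also have "\<dots> = d"
      using p that by (auto simp: homog_in_def mon_deg_def)
    finally show ?thesis
      by (simp add: mon_eval_def power_mult_distrib prod.distrib flip: power_sum)
  qed
  then show ?thesis
    by (simp add: eval_mpol_eq sum_distrib_left ac_simps)
qed

text \<open>Induction on the number of variables. Evaluating the other variables where some
  coefficient with respect to \<open>z\<close> survives leaves a nonzero univariate polynomial,
  which has finitely many roots, while a field of characteristic zero is infinite.\<close>

lemma eval_mpol_nonzero:
  fixes p :: "'k::field_char_0 mpol"
  assumes "p \<noteq> 0"
  obtains \<sigma> where "eval_mpol id \<sigma> p \<noteq> 0"
proof -
  have "\<exists>\<sigma>. eval_mpol id \<sigma> p \<noteq> 0" if "finite J" "p \<in> polys J" "p \<noteq> 0" for J and p :: "'k mpol"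
    using that
  proof (induction J arbitrary: p rule: finite_induct)
    case empty
    then have "keys p \<subseteq> {0}"
      by (auto simp: polys_def)
    then have "p = single 0 (lookup p 0)"
      by (intro poly_mapping_eqI) (auto simp: lookup_single when_def in_keys_iff)
    then have "p = Const (lookup p 0)" "lookup p 0 \<noteq> 0"
      using empty.prems by (auto simp: Const_def)
    then show ?case
      by (metis eval_mpol_Const id_apply)
  next
    case (insert z J)
    obtain k where k: "cf z k p \<noteq> 0"
      using cf_nonzero insert.prems by blast
    have poly_cf: "cf z j p \<in> polys J" for j
      using cf_polys[OF insert.prems(1), of z j] by (rule polys_mono) auto
    from insert.IH[OF poly_cf k] obtain \<sigma> where \<sigma>: "eval_mpol id \<sigma> (cf z k p) \<noteq> 0"
      by blast
    \<comment> \<open>Including \<open>k\<close> guarantees that the surviving coefficient occurs in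
      \<open>u\<close>.\<close>
    define N where "N = Max (insert k ((\<lambda>m. lookup m z) ` keys p))"
    define u where "u = (\<Sum>j\<le>N. monom (eval_mpol id \<sigma> (cf z j p)) j)"
    have "coeff u k = eval_mpol id \<sigma> (cf z k p)"
      by (simp add: u_def coeff_sum N_def)
    with \<sigma> have "u \<noteq> 0" by auto
    then have "finite {x. poly u x = 0}"
      by (rule poly_roots_finite)
    then obtain x where x: "poly u x \<noteq> 0"
      using infinite_UNIV_char_0[where 'a = 'k] by (metis (mono_tags, lifting) UNIV_I finite_subset mem_Collect_eq subsetI)
    interpret ev: comm_ring_hom "eval_mpol id (\<sigma>(z := x))"
      by (rule comm_ring_hom_eval[OF comm_ring_hom_id])
    have "p = (\<Sum>j\<le>N. cf z j p * Var z ^ j)"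
      by (rule mpol_expand_var) (simp add: N_def)
    then have "eval_mpol id (\<sigma>(z := x)) p = eval_mpol id (\<sigma>(z := x)) (\<Sum>j\<le>N. cf z j p * Var z ^ j)"
      by (rule arg_cong)
    also have "\<dots> = (\<Sum>j\<le>N. eval_mpol id (\<sigma>(z := x)) (cf z j p) * x ^ j)"
      by (simp add: ev.hom_sum ev.hom_mult ev.hom_power comm_ring_hom_id)
    also have "\<dots> = (\<Sum>j\<le>N. eval_mpol id \<sigma> (cf z j p) * x ^ j)"
      by (intro sum.cong arg_cong2[of _ _ _ _ "(*)"] eval_mpol_cong[OF poly_cf])
        (use insert.hyps in auto)
    also have "\<dots> = poly u x"
      by (simp add: u_def poly_sum poly_monom)
    finally show ?case using x by metis
  qed
  moreover have "p \<in> polys UNIV"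
    by (simp add: polys_def)
  ultimately show thesis
    using assms that finite_var by blast
qed

subsection \<open>Unique factorization\<close>

text \<open>Iterated univariate polynomial rings are known to be factorial; such a ring is identified with
  \<open>polys J\<close>, one variable at a time.\<close>

definition coord_iso :: "var set \<Rightarrow> ('r::comm_ring_1 \<Rightarrow> 'k::comm_ring_1 mpol) \<Rightarrow> bool" where
  "coord_iso J \<psi> \<longleftrightarrow> comm_ring_hom \<psi> \<and> inj \<psi> \<and> range \<psi> = polys J"

lemma coord_iso_Const: "coord_iso {} (Const :: 'k::comm_ring_1 \<Rightarrow> 'k mpol)"
proof -
  have "p \<in> range Const" if "p \<in> polys {}" for p :: "'k mpol"
  proof -
    have "keys p \<subseteq> {0}"
      using that by (auto simp: polys_def)
    then have "p = Const (lookup p 0)"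
      unfolding Const_def by (intro poly_mapping_eqI) (auto simp: lookup_single when_def in_keys_iff)
    then show ?thesis by blast
  qed
  moreover have "inj (Const :: 'k \<Rightarrow> 'k mpol)"
    unfolding Const_def by (rule injI) (metis lookup_single_eq)
  ultimately show ?thesis
    by (auto simp: coord_iso_def comm_ring_hom_Const)
qed

text \<open>The univariate indeterminate is sent to \<open>Var z\<close>. Coefficients are recovered
  by \<open>cf z\<close>, which gives injectivity; the expansion in powers of \<open>Var z\<close>
  gives surjectivity.\<close>

lemma coord_iso_insert:
  assumes \<psi>: "coord_iso J \<psi>" and z: "z \<notin> J"
  shows "coord_iso (insert z J) (\<lambda>p. poly (map_poly \<psi> p) (Var z))" (is "coord_iso _ ?\<psi>")
proof -
  interpret comm_ring_hom \<psi> using \<psi> by (simp add: coord_iso_def)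
  interpret mp: map_poly_comm_ring_hom \<psi> ..
  have range: "range \<psi> = polys J" and inj: "inj \<psi>"
    using \<psi> by (auto simp: coord_iso_def)
  then have in_J: "\<psi> c \<in> polys J" for c by auto
  then have z_free: "\<psi> c \<in> polys (- {z})" for c
    by (rule polys_mono) (use z in auto)
  have hom: "comm_ring_hom ?\<psi>"
    by unfold_locales (auto simp: mp.hom_add mp.hom_mult)
  then interpret h: comm_ring_hom ?\<psi> .
  have monom: "?\<psi> (monom c k) = \<psi> c * Var z ^ k" for c k
    by (simp add: map_poly_monom poly_monom)
  have sum: "?\<psi> p = (\<Sum>i\<le>degree p. \<psi> (coeff p i) * Var z ^ i)" for p
    by (subst (1) poly_as_sum_of_monoms[of p, symmetric]) (simp only: h.hom_sum monom)
  have "cf z k (?\<psi> p) = \<psi> (coeff p k)" for k p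
  proof -
    have "cf z k (?\<psi> p) = (\<Sum>i\<le>degree p. if k = i then \<psi> (coeff p i) else 0)"
      by (simp only: sum cf_sum cf_mult_Var_power[OF z_free])
    then show ?thesis
      using coeff_eq_0[of p k] by (cases "k \<le> degree p") auto
  qed
  then have "inj ?\<psi>"
    using inj by (intro injI poly_eqI) (metis injD)
  moreover have "range ?\<psi> = polys (insert z J)"
  proof
    show "range ?\<psi> \<subseteq> polys (insert z J)"
      using in_J unfolding sum
      by (auto intro!: polys_sum polys_mult polys_power polys_Var intro: polys_mono)
    show "polys (insert z J) \<subseteq> range ?\<psi>"
    proof
      fix q :: "'b mpol" assume q: "q \<in> polys (insert z J)"
      have "cf z k q \<in> range \<psi>" for k
        unfolding range using cf_polys[OF q, of z k] z by simp
      then obtain c where c: "\<And>k. cf z k q = \<psi> (c k)"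
        by (auto simp: image_iff) metis
      have "q = (\<Sum>k\<le>Max (insert 0 ((\<lambda>m. lookup m z) ` keys q)). \<psi> (c k) * Var z ^ k)"
        unfolding c[symmetric] by (rule mpol_expand_var) simp
      also have "\<dots> = ?\<psi> (\<Sum>k\<le>Max (insert 0 ((\<lambda>m. lookup m z) ` keys q)). monom (c k) k)"
        by (simp only: h.hom_sum monom)
      finally show "q \<in> range ?\<psi>" by blast
    qed
  qed
  ultimately show ?thesis
    using hom by (simp add: coord_iso_def)
qed

text \<open>With all variables present, \<open>\<psi>\<close> is a ring isomorphism and therefore
  preserves and reflects divisibility. This transports the fact that irreducible elements of a
  factorial ring are prime.\<close>

lemma coord_iso_prime:
  fixes \<psi> :: "'r::ufd \<Rightarrow> 'k::idom mpol" and p :: "'k mpol"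
  assumes \<psi>: "coord_iso UNIV \<psi>" and p: "irreducible p"
  shows "prime_elem p"
proof -
  interpret comm_ring_hom \<psi> using \<psi> by (simp add: coord_iso_def)
  have inj: "\<psi> x = \<psi> y \<longleftrightarrow> x = y" for x y
    using \<psi> by (auto simp: coord_iso_def inj_def)
  have surj: "\<exists>x. q = \<psi> x" for q
    using \<psi> by (auto simp: coord_iso_def polys_def)
  have dvd: "\<psi> x dvd \<psi> y \<longleftrightarrow> x dvd y" for x y
  proof
    assume "\<psi> x dvd \<psi> y"
    then show "x dvd y"
      unfolding dvd_def using surj inj hom_mult by metis
  qed (rule hom_dvd)
  obtain x where x: "p = \<psi> x" using surj by blast
  have dvd_1: "\<psi> y dvd 1 \<longleftrightarrow> y dvd 1" for y
    using dvd[of y 1] by simp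
  have "irreducible x"
  proof (rule irreducibleI)
    show "x \<noteq> 0" "\<not> x dvd 1"
      using p x dvd_1 by (auto simp: irreducible_def)
    show "a dvd 1 \<or> b dvd 1" if "x = a * b" for a b
      using p x dvd_1 that by (auto simp: irreducible_def hom_mult)
  qed
  then have px: "prime_elem x" by simp
  show ?thesis
  proof (rule prime_elemI)
    show "p \<noteq> 0" "\<not> p dvd 1" using p by (auto simp: irreducible_def)
    fix a b assume "p dvd a * b"
    moreover obtain a' b' where "a = \<psi> a'" "b = \<psi> b'" using surj by metis
    ultimately show "p dvd a \<or> p dvd b"
      using px x dvd by (metis hom_mult prime_elem_dvd_mult_iff)
  qed
qed

lemma irreducible_imp_prime_mpol:
  fixes p :: "'k::field mpol"
  assumes "irreducible p"
  shows "prime_elem p"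
proof -
  \<comment> \<open>The sets are written in the order in which eight successive adjunctions,
    starting from the constants, build them.\<close>
  have n: "S \<notin> {}" "U \<notin> {S}" "T \<notin> {U,S}" "V \<notin> {T,U,S}" "W \<notin> {V,T,U,S}"
    "X \<notin> {W,V,T,U,S}" "Y \<notin> {X,W,V,T,U,S}" "Z \<notin> {Y,X,W,V,T,U,S}"
    by auto
  have UNIV: "{Z,Y,X,W,V,T,U,S} = UNIV"
    by (auto simp: UNIV_var)
  note coord_iso_insert[OF coord_iso_insert[OF coord_iso_insert[OF coord_iso_insert[OF
    coord_iso_insert[OF coord_iso_insert[OF coord_iso_insert[OF coord_iso_insert[OF
    coord_iso_Const[where 'k = 'k] n(1)] n(2)] n(3)] n(4)] n(5)] n(6)] n(7)] n(8)]
  from coord_iso_prime[OF this[unfolded UNIV] assms] show ?thesis .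
qed

subsection \<open>Sylvester matrices\<close>

text \<open>The value at \<open>(x, y)\<close> of the homogenization of \<open>p\<close> in degree
  \<open>d\<close>; the coefficient at \<open>d\<close> is allowed to vanish.\<close>

definition hom_poly :: "nat \<Rightarrow> 'a::comm_ring_1 poly \<Rightarrow> 'a \<Rightarrow> 'a \<Rightarrow> 'a" where
  "hom_poly d p x y = (\<Sum>k\<le>d. coeff p k * x ^ k * y ^ (d - k))"

text \<open>The monomials of degree \<open>n - 1\<close> in \<open>x\<close> and \<open>y\<close>,
  in the order of the columns of the Sylvester matrix.\<close>

definition powers_vec :: "nat \<Rightarrow> 'a::comm_ring_1 \<Rightarrow> 'a \<Rightarrow> 'a vec" where
  "powers_vec n x y = vec n (\<lambda>i. x ^ (n - 1 - i) * y ^ i)"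

text \<open>The left side is a Sylvester row shifted by \<open>r\<close>, paired with the monomials
  of degree \<open>d + e - 1\<close>. Factoring out the monomial responsible for the shift leaves
  the form itself.\<close>

lemma sum_shifted_coeffs:
  fixes x y :: "'a::comm_ring_1"
  assumes "r < e"
  shows "(\<Sum>j<d + e. (if r \<le> j \<and> j \<le> r + d then coeff p (d + r - j) else 0) * (x ^ (d + e - 1 - j) * y ^ j))
    = x ^ (e - 1 - r) * y ^ r * hom_poly d p x y"
proof -
  have "(\<Sum>j<d + e. (if r \<le> j \<and> j \<le> r + d then coeff p (d + r - j) else 0) * (x ^ (d + e - 1 - j) * y ^ j))
      = (\<Sum>j\<in>{r..r + d}. coeff p (d + r - j) * (x ^ (d + e - 1 - j) * y ^ j))"
    by (rule sum.mono_neutral_cong_right) (use assms in auto)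
  also have "\<dots> = (\<Sum>k\<le>d. coeff p k * (x ^ (d + e - 1 - (r + d - k)) * y ^ (r + d - k)))"
    by (rule sum.reindex_bij_witness[of _ "\<lambda>k. r + d - k" "\<lambda>j. r + d - j"])
      (auto simp: add.commute)
  also have "\<dots> = (\<Sum>k\<le>d. x ^ (e - 1 - r) * y ^ r * (coeff p k * x ^ k * y ^ (d - k)))"
  proof (rule sum.cong)
    fix k assume "k \<in> {..d}"
    then have "d + e - 1 - (r + d - k) = (e - 1 - r) + k" "r + d - k = r + (d - k)"
      using assms by auto
    then show "coeff p k * (x ^ (d + e - 1 - (r + d - k)) * y ^ (r + d - k)) =
        x ^ (e - 1 - r) * y ^ r * (coeff p k * x ^ k * y ^ (d - k))"
      by (simp only: power_add ac_simps)
  qed simp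
  finally show ?thesis
    by (simp add: hom_poly_def sum_distrib_left)
qed

lemma sylvester_mult_powers_vec:
  fixes x y :: "'a::comm_ring_1"
  assumes "i < d + e"
  shows "(sylvester_mat_sub d e p q *\<^sub>v powers_vec (d + e) x y) $ i =
    (if i < e then powers_vec e x y $ i * hom_poly d p x y
     else powers_vec d x y $ (i - e) * hom_poly e q x y)"
proof -
  have "(sylvester_mat_sub d e p q *\<^sub>v powers_vec (d + e) x y) $ i =
      (\<Sum>j<d + e. sylvester_mat_sub d e p q $$ (i, j) * (x ^ (d + e - 1 - j) * y ^ j))"
    using assms by (simp add: scalar_prod_def powers_vec_def atLeast0LessThan)
  also have "\<dots> = (if i < e then powers_vec e x y $ i * hom_poly d p x y
     else powers_vec d x y $ (i - e) * hom_poly e q x y)"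
  proof (cases "i < e")
    case True
    have "(\<Sum>j<d + e. sylvester_mat_sub d e p q $$ (i, j) * (x ^ (d + e - 1 - j) * y ^ j)) =
        (\<Sum>j<d + e. (if i \<le> j \<and> j \<le> i + d then coeff p (d + i - j) else 0) * (x ^ (d + e - 1 - j) * y ^ j))"
      by (rule sum.cong) (use assms True in \<open>auto simp: sylvester_mat_sub_index\<close>)
    also have "\<dots> = x ^ (e - 1 - i) * y ^ i * hom_poly d p x y"
      by (rule sum_shifted_coeffs[OF True])
    finally show ?thesis
      using True by (simp add: powers_vec_def)
  next
    case False
    \<comment> \<open>In the lower block \<open>d\<close> and \<open>e\<close> exchange roles, and
      the shift is \<open>i - e\<close>.\<close>
    have "(\<Sum>j<d + e. sylvester_mat_sub d e p q $$ (i, j) * (x ^ (d + e - 1 - j) * y ^ j)) =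
        (\<Sum>j<e + d. (if i - e \<le> j \<and> j \<le> i - e + e then coeff q (e + (i - e) - j) else 0) * (x ^ (e + d - 1 - j) * y ^ j))"
      by (rule sum.cong) (use assms False in \<open>auto simp: sylvester_mat_sub_index add.commute\<close>)
    also have "\<dots> = x ^ (d - 1 - (i - e)) * y ^ (i - e) * hom_poly e q x y"
      by (rule sum_shifted_coeffs) (use assms False in auto)
    also have "d - 1 - (i - e) = d - Suc (i - e)"
      by simp
    finally show ?thesis
      unfolding powers_vec_def using assms False by (subst index_vec) auto
  qed
  finally show ?thesis .
qed

text \<open>At a common zero the vector of monomials lies in the kernel of the Sylvester matrix. Its
  first and last entries are pure powers of \<open>x\<close> and \<open>y\<close>, so it is nonzero.
  Positivity of \<open>d + e\<close> excludes the empty determinant, which is 1.\<close>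

lemma resultant_sub_common_zero:
  fixes x y :: "'a::idom"
  assumes "hom_poly d p x y = 0" "hom_poly e q x y = 0" "x \<noteq> 0 \<or> y \<noteq> 0" "d + e > 0"
  shows "resultant_sub d e p q = 0"
proof -
  have "powers_vec (d + e) x y \<noteq> 0\<^sub>v (d + e)"
  proof
    assume *: "powers_vec (d + e) x y = 0\<^sub>v (d + e)"
    have "powers_vec (d + e) x y $ 0 = 0" "powers_vec (d + e) x y $ (d + e - 1) = 0"
      unfolding * using assms(4) by auto
    with assms(3,4) show False
      by (auto simp: powers_vec_def)
  qed
  moreover have "sylvester_mat_sub d e p q *\<^sub>v powers_vec (d + e) x y = 0\<^sub>v (d + e)"
    by (rule eq_vecI) (auto simp: sylvester_mult_powers_vec assms(1,2) simp del: index_mult_mat_vec)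
  moreover have "powers_vec (d + e) x y \<in> carrier_vec (d + e)"
    by (simp add: powers_vec_def)
  ultimately show ?thesis
    unfolding resultant_sub_def using det_0_iff_vec_prod_zero[OF sylvester_mat_sub_carrier] by blast
qed

text \<open>A left kernel vector, paired with the monomials, is a relation between the two forms,
  valid for all \<open>x\<close> and \<open>y\<close>. Its entries can be taken free of
  \<open>a\<close> and \<open>b\<close> because the matrix entries are.\<close>

lemma resultant_sub_eq_0_kernel:
  fixes p q :: "'k::idom mpol poly"
  assumes res: "resultant_sub d e p q = 0"
    and p: "\<And>k. coeff p k \<in> polys (- {a,b})" and q: "\<And>k. coeff q k \<in> polys (- {a,b})"
  obtains v where "v \<in> carrier_vec (d + e)" "v \<noteq> 0\<^sub>v (d + e)"
    "\<And>i. i < d + e \<Longrightarrow> v $ i \<in> polys (- {a,b})"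
    "\<And>x y. (\<Sum>i<e. v $ i * powers_vec e x y $ i) * hom_poly d p x y +
      (\<Sum>i<d. v $ (e + i) * powers_vec d x y $ i) * hom_poly e q x y = 0"
proof -
  define M where "M = sylvester_mat_sub d e p q"
  have M: "M \<in> carrier_mat (d + e) (d + e)" by (simp add: M_def sylvester_mat_sub_carrier)
  have M_free: "M $$ (i, j) \<in> polys (- {a,b})" if "i < d + e" "j < d + e" for i j
    using that p q by (simp add: M_def sylvester_mat_sub_index)
  have "det (M\<^sup>T) = 0"
    using res det_transpose[OF M] by (simp add: resultant_sub_def M_def)
  then obtain u where u: "u \<in> carrier_vec (d + e)" "u \<noteq> 0\<^sub>v (d + e)" "M\<^sup>T *\<^sub>v u = 0\<^sub>v (d + e)"
    using det_0_iff_vec_prod_zero[of "M\<^sup>T" "d + e"] M by auto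
  then obtain l where l: "l < d + e" "u $ l \<noteq> 0"
    by (metis carrier_vecD eq_vecI index_zero_vec)
  obtain j where j: "cf b j (u $ l) \<noteq> 0" using cf_nonzero[OF l(2)] by blast
  obtain i where i: "cf a i (cf b j (u $ l)) \<noteq> 0" using cf_nonzero[OF j] by blast
  \<comment> \<open>The kernel vector \<open>u\<close> may involve \<open>a\<close> and
    \<open>b\<close>. Extracting one coefficient from all its entries commutes with multiplication
    by the matrix, and the exponents are chosen so that entry \<open>l\<close> survives.\<close>
  define v where "v = map_vec (\<lambda>r. cf a i (cf b j r)) u"
  have v: "v \<in> carrier_vec (d + e)" using u by (simp add: v_def)
  have "v $ l \<noteq> 0" using i l u by (simp add: v_def)
  then have v_nz: "v \<noteq> 0\<^sub>v (d + e)" using l by auto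
  have v_free: "v $ k \<in> polys (- {a,b})" if "k < d + e" for k
  proof -
    have "u $ k \<in> polys UNIV" by (simp add: polys_def)
    then have "cf a i (cf b j (u $ k)) \<in> polys (UNIV - {b} - {a})" by (intro cf_polys)
    also have "UNIV - {b} - {a} = - {a,b}" by auto
    finally show ?thesis using that u by (simp add: v_def)
  qed
  have col: "(\<Sum>k<d + e. M $$ (k, c) * v $ k) = 0" if c: "c < d + e" for c
  proof -
    have "(M\<^sup>T *\<^sub>v u) $ c = 0" using u(3) c by simp
    then have "(\<Sum>k<d + e. M $$ (k, c) * u $ k) = 0"
      using M u(1) c by (simp add: scalar_prod_def atLeast0LessThan)
    then have "cf a i (cf b j (\<Sum>k<d + e. M $$ (k, c) * u $ k)) = 0" by simp
    moreover have "cf a i (cf b j (M $$ (k, c) * u $ k)) = M $$ (k, c) * v $ k" if "k < d + e" for k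
    proof -
      have "M $$ (k, c) \<in> polys (- {a})" "M $$ (k, c) \<in> polys (- {b})"
        using M_free[OF that c] by (auto intro: polys_mono)
      then show ?thesis
        using that u by (simp add: cf_mult_left v_def)
    qed
    ultimately show ?thesis by (simp add: cf_sum)
  qed
  have sum_split: "(\<Sum>i<l. s i) + (\<Sum>i<n. s (l + i)) = (\<Sum>i<l + n. s i)"
    for s :: "nat \<Rightarrow> 'k mpol" and l n
    by (induction n) (auto simp: ac_simps)
  have "(\<Sum>i<e. v $ i * powers_vec e x y $ i) * hom_poly d p x y +
      (\<Sum>i<d. v $ (e + i) * powers_vec d x y $ i) * hom_poly e q x y = 0" for x y
  proof -
    have "(\<Sum>i<e. v $ i * powers_vec e x y $ i) * hom_poly d p x y +
        (\<Sum>i<d. v $ (e + i) * powers_vec d x y $ i) * hom_poly e q x y =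
      (\<Sum>i<e. v $ i * (M *\<^sub>v powers_vec (d + e) x y) $ i) +
        (\<Sum>i<d. v $ (e + i) * (M *\<^sub>v powers_vec (d + e) x y) $ (e + i))"
      by (simp add: M_def sylvester_mult_powers_vec sum_distrib_right mult.assoc del: index_mult_mat_vec)
    also have "\<dots> = (\<Sum>i<e + d. v $ i * (M *\<^sub>v powers_vec (d + e) x y) $ i)"
      by (rule sum_split)
    also have "\<dots> = (\<Sum>i<d + e. \<Sum>j<d + e. v $ i * (M $$ (i, j) * powers_vec (d + e) x y $ j))"
      using M by (simp add: scalar_prod_def sum_distrib_left atLeast0LessThan add.commute powers_vec_def)
    also have "\<dots> = (\<Sum>j<d + e. (\<Sum>i<d + e. M $$ (i, j) * v $ i) * powers_vec (d + e) x y $ j)"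
      by (subst sum.swap) (simp add: sum_distrib_right mult.assoc mult.left_commute)
    also have "\<dots> = 0" using col by simp
    finally show ?thesis .
  qed
  with that[OF v v_nz v_free] show thesis by blast
qed

lemma (in comm_ring_hom) resultant_sub_hom:
  "resultant_sub d e (map_poly hom p) (map_poly hom q) = hom (resultant_sub d e p q)"
  unfolding resultant_sub_def by (simp add: sylvester_mat_sub_map[symmetric])

lemma (in comm_ring_hom) hom_hom_poly:
  "hom (hom_poly d p x y) = hom_poly d (map_poly hom p) (hom x) (hom y)"
  by (simp add: hom_poly_def hom_distribs coeff_map_poly)

lemma hom_poly_eq_poly:
  assumes "degree p \<le> d"
  shows "hom_poly d p x 1 = poly p x"
proof -
  have "(\<Sum>k\<le>d. coeff p k * x ^ k) = (\<Sum>k\<le>degree p. coeff p k * x ^ k)"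
    by (rule sum.mono_neutral_right) (use assms in \<open>auto simp: coeff_eq_0\<close>)
  then show ?thesis by (simp add: hom_poly_def poly_altdef)
qed

text \<open>Each term of the Leibniz expansion takes one entry from each of the \<open>e\<close>
  rows of degree \<open>i\<close> and the \<open>d\<close> rows of degree \<open>j\<close>.\<close>

lemma resultant_sub_homog:
  fixes p q :: "'k::comm_ring_1 mpol poly"
  assumes p: "\<And>k. homog_in I i (coeff p k)" and q: "\<And>k. homog_in I j (coeff q k)"
  shows "homog_in I (e * i + d * j) (resultant_sub d e p q)"
proof -
  define M where "M = sylvester_mat_sub d e p q"
  have M: "M \<in> carrier_mat (d + e) (d + e)" by (simp add: M_def sylvester_mat_sub_carrier)
  have entry: "homog_in I (if r < e then i else j) (M $$ (r, c))" if "r < d + e" "c < d + e" for r c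
    using that p q by (simp add: M_def sylvester_mat_sub_index)
  have deg: "(\<Sum>r = 0..<d + e. if r < e then i else j) = e * i + d * j"
  proof -
    have "(\<Sum>r = 0..<d + e. if r < e then i else j) = (\<Sum>r\<in>{0..<e} \<union> {e..<d + e}. if r < e then i else j)"
      by (rule sum.cong) auto
    also have "\<dots> = e * i + d * j"
      by (subst sum.union_disjoint) auto
    finally show ?thesis .
  qed
  have "homog_in I (e * i + d * j) (det M)"
    unfolding det_def'[OF M]
  proof (rule homog_in_sum)
    fix \<pi> assume "\<pi> \<in> {\<pi>. \<pi> permutes {0..<d + e}}"
    then have \<pi>: "\<pi> r < d + e" if "r < d + e" for r
      using that permutes_in_image[of \<pi> "{0..<d + e}" r] by auto
    have "homog_in I (\<Sum>r = 0..<d + e. if r < e then i else j) (\<Prod>r = 0..<d + e. M $$ (r, \<pi> r))"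
      by (rule homog_in_prod) (use entry \<pi> in auto)
    moreover have "homog_in I 0 (signof \<pi> :: 'k mpol)"
      using homog_in_uminus[OF homog_in_1] by (cases \<pi> rule: sign_cases) simp_all
    ultimately show "homog_in I (e * i + d * j) (signof \<pi> * (\<Prod>r = 0..<d + e. M $$ (r, \<pi> r)))"
      using homog_in_mult[of I 0] unfolding deg by fastforce
  qed
  then show ?thesis by (simp add: resultant_sub_def M_def)
qed

lemma resultant_sub_polys:
  fixes p q :: "'k::comm_ring_1 mpol poly"
  assumes "\<And>k. coeff p k \<in> polys J" "\<And>k. coeff q k \<in> polys J"
  shows "resultant_sub d e p q \<in> polys J"
  using resultant_sub_homog[of "- J" 0 p 0 q e d] assms by (simp add: polys_iff_homog)

text \<open>The entries carry distinct powers of \<open>Var a\<close>, so extracting the coefficient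
  of one of these powers isolates a single summand.\<close>

lemma sum_powers_vec_eq_0:
  fixes y :: "'k::idom mpol"
  assumes eq: "(\<Sum>i<n. c i * powers_vec n (Var a) y $ i) = 0"
    and c: "\<And>i. i < n \<Longrightarrow> c i \<in> polys (- {a})" and y: "y \<in> polys (- {a})" "y \<noteq> 0" and i: "i < n"
  shows "c i = 0"
proof -
  have "cf a (n - 1 - i) (c j * powers_vec n (Var a) y $ j) = (if j = i then c i * y ^ i else 0)"
    if j: "j < n" for j
  proof -
    have eq: "c j * powers_vec n (Var a) y $ j = (c j * y ^ j) * Var a ^ (n - 1 - j)"
      using j by (simp add: powers_vec_def ac_simps)
    have "c j * y ^ j \<in> polys (- {a})"
      using c[OF j] y(1) by (intro polys_mult polys_power)
    then have "cf a (n - 1 - i) (c j * powers_vec n (Var a) y $ j) =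
        (if n - 1 - i = n - 1 - j then c j * y ^ j else 0)"
      unfolding eq by (rule cf_mult_Var_power)
    also have "n - 1 - i = n - 1 - j \<longleftrightarrow> j = i"
      using i j by auto
    finally show ?thesis
      by (cases "j = i") simp_all
  qed
  then have "cf a (n - 1 - i) (\<Sum>j<n. c j * powers_vec n (Var a) y $ j) =
      (\<Sum>j<n. if j = i then c i * y ^ i else 0)"
    by (simp add: cf_sum)
  also have "\<dots> = c i * y ^ i"
    using i by simp
  finally have "c i * y ^ i = 0"
    unfolding eq by simp
  then show ?thesis using y by simp
qed

text \<open>A vanishing resultant gives \<open>P * ?p + Q * ?q = 0\<close> with coefficients not all
  zero, and primality forces \<open>?p\<close> to divide \<open>Q\<close>. The condition
  \<open>small\<close> says abstractly that \<open>Q\<close> has too small a degree for that. It is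
  left abstract to cover both the degree in two variables, with \<open>y = Var b\<close>, and the
  degree in one variable, with \<open>a = b\<close> and \<open>y = 1\<close>.\<close>

lemma resultant_sub_nonzero:
  fixes p q :: "'k::idom mpol poly"
  assumes p: "\<And>k. coeff p k \<in> polys (- {a,b})" and q: "\<And>k. coeff q k \<in> polys (- {a,b})"
    and y: "y \<in> polys (- {a})" "y \<noteq> 0"
    and prime: "prime_elem (hom_poly d p (Var a) y)"
    and ndvd: "\<not> hom_poly d p (Var a) y dvd hom_poly e q (Var a) y"
    and small: "\<And>c. (\<And>i. i < d \<Longrightarrow> c i \<in> polys (- {a,b})) \<Longrightarrow>
      hom_poly d p (Var a) y dvd (\<Sum>i<d. c i * powers_vec d (Var a) y $ i) \<Longrightarrow>
      (\<Sum>i<d. c i * powers_vec d (Var a) y $ i) = 0"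
  shows "resultant_sub d e p q \<noteq> 0"
proof
  let ?p = "hom_poly d p (Var a) y" and ?q = "hom_poly e q (Var a) y"
  assume "resultant_sub d e p q = 0"
  then obtain v where
    v: "v \<in> carrier_vec (d + e)" "v \<noteq> 0\<^sub>v (d + e)" "\<And>i. i < d + e \<Longrightarrow> v $ i \<in> polys (- {a,b})" and
    rel: "\<And>x y. (\<Sum>i<e. v $ i * powers_vec e x y $ i) * hom_poly d p x y +
      (\<Sum>i<d. v $ (e + i) * powers_vec d x y $ i) * hom_poly e q x y = 0"
    by (rule resultant_sub_eq_0_kernel[OF _ p q]) (rule that; (assumption | simp only:))
  define P Q where "P = (\<Sum>i<e. v $ i * powers_vec e (Var a) y $ i)"
    and "Q = (\<Sum>i<d. v $ (e + i) * powers_vec d (Var a) y $ i)"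
  have PQ: "P * ?p + Q * ?q = 0"
    unfolding P_def Q_def by (rule rel)
  then have "Q * ?q = - P * ?p"
    by (simp add: eq_neg_iff_add_eq_0 add.commute)
  then have "?p dvd Q * ?q" by (metis dvd_triv_right)
  then have dvd: "?p dvd Q"
    using prime_elem_dvd_multD[OF prime] ndvd by metis
  have "v $ (e + i) \<in> polys (- {a,b})" if "i < d" for i
    using v(3) that by simp
  from small[of "\<lambda>i. v $ (e + i)", folded Q_def, OF this dvd] have Q: "Q = 0" .
  have P: "P = 0"
    using PQ prime unfolding Q by auto
  have free: "v $ i \<in> polys (- {a})" if "i < d + e" for i
    using v(3)[OF that] by (rule polys_mono) auto
  have "v $ i = 0" if "i < e" for i
    using sum_powers_vec_eq_0[OF P[unfolded P_def] _ y that] free by simp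
  moreover have "v $ (e + i) = 0" if "i < d" for i
    using sum_powers_vec_eq_0[OF Q[unfolded Q_def] _ y that] free by simp
  ultimately have "v $ i = 0" if "i < d + e" for i
    using that by (metis add.commute le_add_diff_inverse less_diff_conv2 linorder_not_le)
  with v(1) have "v = 0\<^sub>v (d + e)" by (intro eq_vecI) auto
  with v(2) show False by (rule notE)
qed

subsection \<open>Resultants of forms in two variables\<close>

lemma coeff_dehom: "coeff (dehom a b d p) k = (if k \<le> d then coeff_at a b k (d - k) p else 0)"
  by (simp add: dehom_def coeff_sum)

lemma cf_homog:
  assumes "homog_in I k p" "z \<notin> I"
  shows "homog_in I k (cf z j p)"
  unfolding homog_in_def
proof
  fix n assume "n \<in> keys (cf z j p)"
  then have "n + single z j \<in> keys p"
    by (auto simp: in_keys_iff lookup_cf split: if_splits)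
  then show "mon_deg I n = k"
    using assms by (auto simp: homog_in_def mon_deg_add mon_deg_single)
qed

lemma coeff_dehom_homog:
  assumes "a \<noteq> b" "homog_in I k p" "a \<notin> I" "b \<notin> I"
  shows "homog_in I k (coeff (dehom a b d p) i)"
  using assms by (simp add: coeff_dehom coeff_at_eq_cf cf_homog)

lemma coeff_dehom_polys:
  assumes "a \<noteq> b" "p \<in> polys J"
  shows "coeff (dehom a b d p) i \<in> polys (J - {a,b})"
proof -
  have "cf a i (cf b j p) \<in> polys (J - {a,b})" for j
    using cf_polys[OF cf_polys[OF assms(2), of b j], of a i] by (rule polys_mono) auto
  then show ?thesis using assms by (simp add: coeff_dehom coeff_at_eq_cf)
qed

lemma hom_poly_dehom:
  assumes "a \<noteq> b" "homog_in {a,b} d p"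
  shows "hom_poly d (dehom a b d p) (Var a) (Var b) = p"
  using mpol_expand_homog[OF assms] by (simp add: hom_poly_def coeff_dehom)

lemma hom_resultant_homog:
  fixes p q :: "'k::comm_ring_1 mpol"
  assumes "a \<noteq> b" "homog_in I i p" "homog_in I j q" "a \<notin> I" "b \<notin> I"
  shows "homog_in I (e * i + d * j) (hom_resultant a b d e p q)"
  unfolding hom_resultant_def by (rule resultant_sub_homog) (rule coeff_dehom_homog; use assms in simp)+

lemma hom_resultant_polys:
  fixes p q :: "'k::comm_ring_1 mpol"
  assumes "a \<noteq> b" "p \<in> polys J" "q \<in> polys J"
  shows "hom_resultant a b d e p q \<in> polys (J - {a,b})"
  unfolding hom_resultant_def by (rule resultant_sub_polys) (rule coeff_dehom_polys; use assms in simp)+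

lemma hom_resultant_nonzero:
  fixes p q :: "'k::idom mpol"
  assumes ab: "a \<noteq> b" and p: "homog_in {a,b} d p" and q: "homog_in {a,b} e q"
    and prime: "prime_elem p" and ndvd: "\<not> p dvd q"
  shows "hom_resultant a b d e p q \<noteq> 0"
  unfolding hom_resultant_def
proof (rule resultant_sub_nonzero[where a = a and b = b and y = "Var b"])
  show "coeff (dehom a b d p) k \<in> polys (- {a,b})" "coeff (dehom a b e q) k \<in> polys (- {a,b})" for k
    using coeff_dehom_polys[OF ab, of _ UNIV] by (simp_all add: Compl_eq_Diff_UNIV polys_def)
  show "Var b \<in> polys (- {a})" using ab by (simp add: polys_Var)
  show "(Var b :: 'k mpol) \<noteq> 0" by (rule Var_nonzero)
  show "prime_elem (hom_poly d (dehom a b d p) (Var a) (Var b))"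
    "\<not> hom_poly d (dehom a b d p) (Var a) (Var b) dvd hom_poly e (dehom a b e q) (Var a) (Var b)"
    using prime ndvd by (simp_all add: hom_poly_dehom ab p q)
  fix c :: "nat \<Rightarrow> 'k mpol"
  let ?Q = "\<Sum>i<d. c i * powers_vec d (Var a) (Var b) $ i"
  assume c: "\<And>i. i < d \<Longrightarrow> c i \<in> polys (- {a,b})"
    and "hom_poly d (dehom a b d p) (Var a) (Var b) dvd ?Q"
  then have "p dvd ?Q" by (simp add: hom_poly_dehom ab p)
  then obtain r where r: "?Q = p * r" by blast
  \<comment> \<open>A nonzero multiple of \<open>p\<close> that is a form in \<open>a\<close>,
    \<open>b\<close> has degree at least \<open>d\<close>, which will contradict this
    degree.\<close>
  have Q: "homog_in {a,b} (d - 1) ?Q"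
  proof (rule homog_in_sum)
    fix i assume i: "i \<in> {..<d}"
    have "homog_in {a,b} (0 + ((d - 1 - i) * 1 + i * 1)) (c i * (Var a ^ (d - 1 - i) * Var b ^ i))"
      using c i homog_in_Var[of "{a,b}" a, where 'a = 'k] homog_in_Var[of "{a,b}" b, where 'a = 'k]
      by (intro homog_in_mult homog_in_power homog_in_polys[of _ "- {a,b}"]) auto
    with i show "homog_in {a,b} (d - 1) (c i * powers_vec d (Var a) (Var b) $ i)"
      by (simp add: powers_vec_def)
  qed
  show "?Q = 0"
  proof (rule ccontr)
    assume nz: "?Q \<noteq> 0"
    \<comment> \<open>For \<open>d = 0\<close> the sum is empty; excluding this makes
      \<open>d - 1\<close> really smaller than \<open>d\<close>.\<close>
    then have "d > 0" by (cases d) auto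
    obtain i j where "i + j = d - 1" "homog_in {a,b} i p" "homog_in {a,b} j r"
      using Q nz unfolding r by (rule homog_in_factor)
    moreover have "p \<noteq> 0" using prime by auto
    ultimately show False
      using homog_in_unique[OF p] \<open>d > 0\<close> by fastforce
  qed
qed

subsection \<open>A projective Nullstellensatz for hypersurfaces\<close>

text \<open>If \<open>F\<close> does not divide \<open>G\<close>, their resultant with respect to a
  variable \<open>z\<close> of \<open>F\<close> is nonzero. At a point where neither it nor the
  leading coefficient of \<open>F\<close> vanishes, \<open>F\<close> has a root in \<open>z\<close>;
  there \<open>G\<close> vanishes too, so the resultant must vanish, a contradiction. A second
  variable from \<open>J\<close> is kept nonzero because \<open>van\<close> says nothing about
  points whose coordinates in \<open>J\<close> are all zero.\<close>

lemma irreducible_dvd_if_vanishes: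
  fixes F G :: "'k::{alg_closed_field, field_char_0} mpol"
  assumes irr: "irreducible F" and F: "F \<in> polys J" and J: "\<And>z. z \<in> J \<Longrightarrow> \<exists>y\<in>J. y \<noteq> z"
    and van: "\<And>\<sigma>. \<exists>y\<in>J. \<sigma> y \<noteq> 0 \<Longrightarrow> eval_mpol id \<sigma> F = 0 \<Longrightarrow> eval_mpol id \<sigma> G = 0"
  shows "F dvd G"
proof (rule ccontr)
  assume ndvd: "\<not> F dvd G"
  have prime: "prime_elem F" by (rule irreducible_imp_prime_mpol[OF irr])
  \<comment> \<open>A constant over a field is zero or a unit, hence not irreducible. So some
    variable \<open>z\<close> occurs in \<open>F\<close>.\<close>
  have "\<not> keys F \<subseteq> {0}"
  proof
    assume "keys F \<subseteq> {0}"
    then have eq: "F = Const (lookup F 0)"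
      unfolding Const_def by (intro poly_mapping_eqI) (auto simp: lookup_single when_def in_keys_iff)
    have "lookup F 0 \<noteq> 0"
      using eq irr by (auto simp: Const_def irreducible_def)
    then have "Const (lookup F 0) * Const (1 / lookup F 0) = (1 :: 'k mpol)"
      by (simp add: Const_def mult_single)
    then have "F dvd 1" using eq by (metis dvdI)
    with irr show False by (simp add: irreducible_def)
  qed
  then obtain m where m: "m \<in> keys F" "m \<noteq> 0" by auto
  then obtain z where z: "lookup m z \<noteq> 0"
    by (auto simp: poly_mapping_eq_iff fun_eq_iff)
  then have "z \<in> J"
    using F m polysD in_keys_iff by metis
  then obtain y where y: "y \<in> J" "y \<noteq> z" using J by blast
  define d e where "d = Max ((\<lambda>m. lookup m z) ` keys F)" and "e = Max (insert 0 ((\<lambda>m. lookup m z) ` keys G))"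
  define p q where "p = (\<Sum>k\<le>d. monom (cf z k F) k)" and "q = (\<Sum>k\<le>e. monom (cf z k G) k)"
  have cp: "coeff p k = (if k \<le> d then cf z k F else 0)" and cq: "coeff q k = (if k \<le> e then cf z k G else 0)" for k
    by (simp_all add: p_def q_def coeff_sum)
  have le_d: "lookup m z \<le> d" if "m \<in> keys F" for m using that by (simp add: d_def)
  then have "d \<noteq> 0" using z m by fastforce
  have "d \<in> (\<lambda>m. lookup m z) ` keys F"
    unfolding d_def by (rule Max_in) (use m in auto)
  then obtain md where md: "md \<in> keys F" "lookup md z = d" by blast
  have lead: "cf z d F \<noteq> 0"
  proof
    assume "cf z d F = 0"
    then have "lookup (cf z d F) (md - single z d) = 0" by simp
    moreover have "lookup (md - single z d) z = 0 \<and> md = (md - single z d) + single z d"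
      using minus_single_eq_iff[OF md(2), of "md - single z d"] by blast
    ultimately show False
      using md(1) by (metis in_keys_iff lookup_cf)
  qed
  have pF: "hom_poly d p (Var z) 1 = F" "hom_poly e q (Var z) 1 = G"
    using mpol_expand_var[of F z d, OF le_d] mpol_expand_var[of G z e]
    by (simp_all add: hom_poly_def cp cq e_def)
  have cf_free: "cf z k r \<in> polys (- {z})" for k and r :: "'k mpol"
    using cf_polys[OF polys_UNIV, of z k r] by (simp add: Compl_eq_Diff_UNIV)
  then have free: "coeff p k \<in> polys (- {z})" "coeff q k \<in> polys (- {z})" for k
    by (simp_all add: cp cq)
  define res where "res = resultant_sub d e p q"
  have "res \<noteq> 0"
    unfolding res_def
  \<comment> \<open>Here the one variable \<open>z\<close> takes the place of both \<open>a\<close>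
    and \<open>b\<close>, and degrees are degrees in \<open>z\<close>.\<close>
  proof (rule resultant_sub_nonzero[where a = z and b = z and y = 1])
    show "coeff p k \<in> polys (- {z,z})" "coeff q k \<in> polys (- {z,z})" for k
      using free by simp_all
    fix c :: "nat \<Rightarrow> 'k mpol"
    let ?Q = "\<Sum>i<d. c i * powers_vec d (Var z) 1 $ i"
    assume c: "\<And>i. i < d \<Longrightarrow> c i \<in> polys (- {z,z})" and "hom_poly d p (Var z) 1 dvd ?Q"
    then obtain r where r: "?Q = F * r" unfolding pF by blast
    show "?Q = 0"
    proof (rule ccontr)
      assume nz: "?Q \<noteq> 0"
      then have "r \<noteq> 0" using r by auto
      then have "Max ((\<lambda>m. lookup m z) ` keys r) \<in> (\<lambda>m. lookup m z) ` keys r"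
        by (intro Max_in) auto
      then obtain mr where mr: "mr \<in> keys r" "Max ((\<lambda>m. lookup m z) ` keys r) = lookup mr z" by blast
      have mr_max: "lookup m z \<le> lookup mr z" if "m \<in> keys r" for m
        unfolding mr(2)[symmetric] using that by simp
      \<comment> \<open>A nonzero multiple of \<open>F\<close> has degree at least \<open>d\<close>
        in \<open>z\<close>, whereas \<open>?Q\<close> only reaches \<open>d - 1\<close>.\<close>
      have "\<exists>m\<in>keys (F * r). int (lookup m z) = int (lookup md z) + int (lookup mr z)"
        by (rule keys_mult_max) (use md le_d mr mr_max in \<open>auto simp: lookup_add\<close>)
      then obtain m where m: "m \<in> keys ?Q" "lookup m z \<ge> d"
        using md(2) r by force
      obtain i where i: "i < d" "m \<in> keys (c i * powers_vec d (Var z) 1 $ i)"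
        using m(1) Poly_Mapping.keys_sum[of "\<lambda>i. c i * powers_vec d (Var z) 1 $ i" "{..<d}"] by blast
      then have "m \<in> keys (c i * Var z ^ (d - 1 - i))"
        by (simp add: powers_vec_def)
      then obtain m1 where m1: "m1 \<in> keys (c i)" "m = m1 + single z (d - 1 - i)"
        using keys_mult[of "c i" "Var z ^ (d - 1 - i)"] by (auto simp: Var_power)
      have "lookup m1 z = 0"
        using polysD[OF c[OF i(1)] m1(1), of z] by (auto simp: in_keys_iff)
      with m1 m(2) \<open>d \<noteq> 0\<close> show False by (simp add: lookup_add)
    qed
  qed (use prime ndvd pF in auto)
  \<comment> \<open>The first factor supplies the contradiction, the second the existence of a root,
    the third a nonzero coordinate.\<close>
  with lead have "res * cf z d F * Var y \<noteq> 0"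
    by (simp add: Var_nonzero)
  then obtain \<sigma> where \<sigma>: "eval_mpol id \<sigma> (res * cf z d F * Var y) \<noteq> 0"
    by (rule eval_mpol_nonzero)
  interpret s: comm_ring_hom "eval_mpol id \<sigma>"
    by (rule comm_ring_hom_eval[OF comm_ring_hom_id])
  have nz: "eval_mpol id \<sigma> res \<noteq> 0" "eval_mpol id \<sigma> (cf z d F) \<noteq> 0" "\<sigma> y \<noteq> 0"
    using \<sigma> by (auto simp: s.hom_mult comm_ring_hom_id)
  let ?u = "map_poly (eval_mpol id \<sigma>) p"
  have "coeff ?u d \<noteq> 0"
    using nz by (simp add: coeff_map_poly cp)
  then have "degree ?u \<noteq> 0"
    using le_degree[of ?u d] \<open>d \<noteq> 0\<close> by auto
  then obtain x where x: "poly ?u x = 0"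
    using alg_closed_imp_poly_has_root[of ?u] by auto
  \<comment> \<open>Moving only the \<open>z\<close>-coordinate to the root leaves the values of
    \<open>res\<close>, of the coefficients and of \<open>y\<close> unchanged.\<close>
  define \<tau> where "\<tau> = \<sigma>(z := x)"
  interpret t: comm_ring_hom "eval_mpol id \<tau>"
    by (rule comm_ring_hom_eval[OF comm_ring_hom_id])
  have \<sigma>\<tau>: "eval_mpol id \<tau> r = eval_mpol id \<sigma> r" if "r \<in> polys (- {z})" for r :: "'k mpol"
    by (rule eval_mpol_cong[OF that]) (auto simp: \<tau>_def)
  have map_\<sigma>\<tau>: "map_poly (eval_mpol id \<tau>) p = ?u"
    by (rule poly_eqI) (simp add: coeff_map_poly \<sigma>\<tau> free)
  have "degree ?u \<le> d"
    by (rule degree_le) (simp add: coeff_map_poly cp)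
  have "\<tau> z = x" by (simp add: \<tau>_def)
  have ev: "eval_mpol id \<tau> (hom_poly n r (Var z) 1) = hom_poly n (map_poly (eval_mpol id \<tau>) r) x 1" for n r
    by (simp add: t.hom_hom_poly comm_ring_hom_id \<open>\<tau> z = x\<close>)
  then have F0: "hom_poly d ?u x 1 = 0"
    using \<open>degree ?u \<le> d\<close> x by (simp only: hom_poly_eq_poly)
  then have "eval_mpol id \<tau> F = 0"
    using ev[of d p] pF map_\<sigma>\<tau> by simp
  moreover have "\<tau> y \<noteq> 0" using y nz by (simp add: \<tau>_def)
  ultimately have "eval_mpol id \<tau> G = 0" using van y by blast
  then have "hom_poly e (map_poly (eval_mpol id \<tau>) q) x 1 = 0"
    using ev[of e q] pF by simp
  then have "resultant_sub d e (map_poly (eval_mpol id \<tau>) p) (map_poly (eval_mpol id \<tau>) q) = 0"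
    using F0 \<open>d \<noteq> 0\<close> by (intro resultant_sub_common_zero[of d _ x 1]) (auto simp: map_\<sigma>\<tau>)
  then have "eval_mpol id \<tau> res = 0"
    by (simp add: t.resultant_sub_hom res_def)
  moreover have "res \<in> polys (- {z})"
    unfolding res_def by (rule resultant_sub_polys[OF free])
  ultimately show False using nz \<sigma>\<tau> by simp
qed

subsection \<open>Polynomials following a parametrization\<close>

abbreviation subst_par :: "'k::field mpol vec \<Rightarrow> 'k mpol \<Rightarrow> 'k mpol" where
  "subst_par h \<equiv> eval_mpol Const (assign (Var S) (Var U) (Var T) (Var V) h)"

text \<open>A representative of an image point is a scalar multiple of a value of \<open>h\<close>.
  Homogeneity pulls the scalar out, and evaluating \<open>G\<close> at that value specializes the
  zero polynomial \<open>subst_par h G\<close>.\<close>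

lemma eval_pt_image:
  assumes G: "G \<in> forms" "subst_par h G = 0" and h: "dim_vec h = 4" and q: "q \<in> image_of h"
  shows "eval_pt q G = 0"
proof -
  obtain s u t v c where q_eq: "q = c \<cdot>\<^sub>v map_vec (eval_mpol id (assign s u t v (0\<^sub>v 4))) h"
    using q by (auto simp: image_of_def)
  define q0 where "q0 = map_vec (eval_mpol id (assign s u t v (0\<^sub>v 4))) h"
  have dim: "dim_vec q0 = 4" using h by (simp add: q0_def)
  obtain k where k: "G \<in> polys {W,X,Y,Z}" "homog_in {W,X,Y,Z} k G"
    using G by (auto simp: forms_def)
  interpret ev: comm_ring_hom "eval_mpol id (assign s u t v (0\<^sub>v 4))"
    by (rule comm_ring_hom_eval[OF comm_ring_hom_id])
  have "eval_pt q G = eval_mpol id (\<lambda>i. c * assign 0 0 0 0 q0 i) G"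
    unfolding eval_pt_def
    by (rule eval_mpol_cong[OF k(1)]) (use dim in \<open>auto simp: q_eq simp flip: q0_def\<close>)
  also have "\<dots> = c ^ k * eval_mpol id (assign 0 0 0 0 q0) G"
    by (rule eval_mpol_scale[OF k(2,1)])
  also have "eval_mpol id (assign 0 0 0 0 q0) G =
      eval_mpol (\<lambda>a. eval_mpol id (assign s u t v (0\<^sub>v 4)) (Const a))
        (\<lambda>i. eval_mpol id (assign s u t v (0\<^sub>v 4)) (assign (Var S) (Var U) (Var T) (Var V) h i)) G"
  proof -
    have "(\<lambda>a. eval_mpol id (assign s u t v (0\<^sub>v 4)) (Const a)) = id"
      by auto
    then show ?thesis
      using h by (auto simp: q0_def intro!: eval_mpol_cong[OF k(1)])
  qed
  also have "\<dots> = eval_mpol id (assign s u t v (0\<^sub>v 4)) (subst_par h G)"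
    by (rule ev.hom_eval_mpol[symmetric])
  also have "\<dots> = 0" using G by simp
  finally show ?thesis by simp
qed

text \<open>The zero locus of \<open>G\<close> is closed and contains the image, hence contains its
  closure, the zero locus of \<open>F\<close>; the Nullstellensatz for hypersurfaces
  applies.\<close>

lemma implicit_equation_dvd:
  fixes F G :: "'k::{alg_closed_field, field_char_0} mpol"
  assumes F: "is_implicit_equation h F" and G: "G \<in> forms" "subst_par h G = 0" and h: "dim_vec h = 4"
  shows "F dvd G"
proof (rule irreducible_dvd_if_vanishes[where J = "{W,X,Y,Z}"])
  have F': "F \<in> forms" "irreducible F" "zero_locus {F} = zariski_closure (image_of h)"
    using F by (auto simp: is_implicit_equation_def)
  then show "irreducible F" "F \<in> polys {W,X,Y,Z}" by (auto simp: forms_def)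
  have "image_of h \<subseteq> proj3" unfolding image_of_def by blast
  then have "image_of h \<subseteq> zero_locus {G}"
    using eval_pt_image[OF G h] by (auto simp: zero_locus_def)
  moreover have "zariski_closed (zero_locus {G})"
    unfolding zariski_closed_def using G by blast
  ultimately have sub: "zero_locus {F} \<subseteq> zero_locus {G}"
    unfolding F'(3) zariski_closure_def by blast
  fix \<sigma> :: "var \<Rightarrow> 'k"
  assume y: "\<exists>y\<in>{W,X,Y,Z}. \<sigma> y \<noteq> 0" and F0: "eval_mpol id \<sigma> F = 0"
  define q where "q = vec 4 (\<lambda>i. [\<sigma> W, \<sigma> X, \<sigma> Y, \<sigma> Z] ! i)"
  have q: "q \<in> carrier_vec 4" "q $ 0 = \<sigma> W" "q $ 1 = \<sigma> X" "q $ 2 = \<sigma> Y" "q $ 3 = \<sigma> Z"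
    by (simp_all add: q_def)
  have "q \<noteq> 0\<^sub>v 4"
  proof
    assume "q = 0\<^sub>v 4"
    then have "q $ 0 = 0" "q $ 1 = 0" "q $ 2 = 0" "q $ 3 = 0" by simp_all
    with y show False unfolding q by auto
  qed
  with q(1) have "q \<in> proj3" by (simp add: proj3_def)
  have ev: "eval_pt q H = eval_mpol id \<sigma> H" if "H \<in> forms" for H
    unfolding eval_pt_def by (rule eval_mpol_cong[of _ "{W,X,Y,Z}"]) (use that q in \<open>auto simp: forms_def\<close>)
  have "q \<in> zero_locus {F}"
    using \<open>q \<in> proj3\<close> F0 ev[OF F'(1)] by (simp add: zero_locus_def)
  with sub have "q \<in> zero_locus {G}" by blast
  then show "eval_mpol id \<sigma> G = 0"
    using ev[OF G(1)] by (simp add: zero_locus_def)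
qed blast

text \<open>The substitution fixes \<open>t\<close> and \<open>v\<close> but may bring them into the
  coefficients. The resultant of the new coefficient polynomials still vanishes, since these have
  the common zero \<open>(Var T, Var V)\<close> over the big ring.\<close>

lemma subst_par_hom_resultant:
  fixes F G :: "'k::field mpol"
  assumes F: "homog_in {T,V} d F" "subst_par h F = 0" and G: "homog_in {T,V} e G" "subst_par h G = 0"
    and pos: "d + e > 0"
  shows "subst_par h (hom_resultant T V d e F G) = 0"
proof -
  interpret s: comm_ring_hom "subst_par h"
    by (rule comm_ring_hom_eval[OF comm_ring_hom_Const])
  have zero: "hom_poly n (map_poly (subst_par h) (dehom T V n H)) (Var T) (Var V) = 0"
    if "homog_in {T,V} n H" "subst_par h H = 0" for n H
    using s.hom_hom_poly[of n "dehom T V n H" "Var T" "Var V"] that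
    by (simp add: hom_poly_dehom comm_ring_hom_Const)
  show ?thesis
    unfolding hom_resultant_def s.resultant_sub_hom[symmetric]
    by (rule resultant_sub_common_zero[OF zero[OF F] zero[OF G]]) (use pos in \<open>simp_all add: Var_nonzero\<close>)
qed

lemma deg_in_homog:
  assumes "homog_in I k p" "p \<noteq> 0"
  shows "deg_in I p = k"
proof -
  obtain m where "m \<in> keys p" using assms by (metis all_not_in_conv keys_eq_empty)
  then have "mon_deg I ` keys p = {k}"
    using assms by (auto simp: homog_in_def image_iff)
  then show ?thesis by (simp add: deg_in_def)
qed

subsection \<open>Syzygies\<close>

lemma all_less_4: "(\<forall>i<4. P i) \<longleftrightarrow> P 0 \<and> P 1 \<and> P 2 \<and> P (3::nat)"
  by (auto simp: numeral_eq_Suc less_Suc_eq)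

text \<open>Lets statements about the first basis vector be applied to each of the three.\<close>

lemma syz_basis_permute:
  assumes "is_syz_basis f a b c"
  shows "is_syz_basis f b a c" "is_syz_basis f c a b"
proof -
  have car: "a \<in> carrier_vec 4" "b \<in> carrier_vec 4" "c \<in> carrier_vec 4"
    using assms by (auto simp: is_syz_basis_def syz_def)
  have 1: "\<beta> \<cdot>\<^sub>v b + \<alpha> \<cdot>\<^sub>v a + \<gamma> \<cdot>\<^sub>v c = \<alpha> \<cdot>\<^sub>v a + \<beta> \<cdot>\<^sub>v b + \<gamma> \<cdot>\<^sub>v c"
    "\<gamma> \<cdot>\<^sub>v c + \<alpha> \<cdot>\<^sub>v a + \<beta> \<cdot>\<^sub>v b = \<alpha> \<cdot>\<^sub>v a + \<beta> \<cdot>\<^sub>v b + \<gamma> \<cdot>\<^sub>v c" for \<alpha> \<beta> \<gamma>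
    using car by (auto intro!: eq_vecI)
  show "is_syz_basis f b a c"
    using assms unfolding is_syz_basis_def 1(1) by blast
  show "is_syz_basis f c a b"
    using assms unfolding is_syz_basis_def 1(2) by blast
qed

lemma syz_basis_nonzero:
  fixes a :: "'k::field mpol vec"
  assumes "is_syz_basis f a b c"
  shows "a \<noteq> 0\<^sub>v 4"
proof
  assume "a = 0\<^sub>v 4"
  moreover have "b \<in> carrier_vec 4" "c \<in> carrier_vec 4"
    using assms by (auto simp: is_syz_basis_def syz_def)
  ultimately have "1 \<cdot>\<^sub>v a + 0 \<cdot>\<^sub>v b + 0 \<cdot>\<^sub>v c = 0\<^sub>v 4"
    by (auto intro!: eq_vecI)
  moreover have "(1 :: 'k mpol) \<in> polys {S,U}" "(0 :: 'k mpol) \<in> polys {S,U}" by simp_all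
  ultimately have "(1 :: 'k mpol) = 0"
    using assms unfolding is_syz_basis_def by blast
  then show False by simp
qed

text \<open>Dividing \<open>a\<close> by a common factor \<open>e\<close> of its entries gives
  another syzygy. Writing it in the basis and comparing with \<open>a\<close>, uniqueness of
  coordinates makes \<open>e\<close> a unit.\<close>

lemma syz_basis_primitive:
  fixes a :: "'k::field mpol vec"
  assumes basis: "is_syz_basis f a b c" and f: "f \<in> carrier_vec 4"
    and dvd: "\<And>i. i < 4 \<Longrightarrow> e dvd a $ i"
  shows "e dvd 1"
proof -
  have a: "a \<in> carrier_vec 4" "set\<^sub>v a \<subseteq> polys {S,U}" "a \<bullet> f = 0" and car: "b \<in> carrier_vec 4" "c \<in> carrier_vec 4"
    using basis by (auto simp: is_syz_basis_def syz_def)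
  have a_SU: "a $ i \<in> polys {S,U}" if "i < 4" for i
    using a(1,2) that vec_setI[of a i] by auto
  obtain l where l: "l < 4" "a $ l \<noteq> 0"
    using syz_basis_nonzero[OF basis] a(1) by (metis carrier_vecD eq_vecI index_zero_vec)
  \<comment> \<open>The value 0 for a vanishing entry keeps all quotients in
    \<open>polys {S,U}\<close>.\<close>
  define r where "r i = (if a $ i = 0 then 0 else SOME r. a $ i = e * r)" for i
  have r: "a $ i = e * r i" if "i < 4" for i
    using dvd[OF that] unfolding r_def dvd_def by (auto intro: someI_ex)
  have e: "e \<noteq> 0" using l r by auto
  have e_SU: "e \<in> polys {S,U}"
    using polys_factor(1)[of e "r l" "{S,U}"] a_SU l r by metis
  have r_SU: "r i \<in> polys {S,U}" if "i < 4" for i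
  proof (cases "a $ i = 0")
    case False
    then show ?thesis using polys_factor(2)[of e "r i" "{S,U}"] a_SU r that by metis
  qed (simp add: r_def)
  define a' where "a' = vec 4 r"
  have a': "a' \<in> carrier_vec 4" by (simp add: a'_def)
  have a_eq: "a = e \<cdot>\<^sub>v a'"
    by (rule eq_vecI) (use a(1) r in \<open>auto simp: a'_def\<close>)
  have "e * (a' \<bullet> f) = 0"
    using a(3) a' f unfolding a_eq by simp
  with e have "a' \<bullet> f = 0" by simp
  moreover have "set\<^sub>v a' \<subseteq> polys {S,U}"
    using r_SU by (auto simp: a'_def vec_set_def)
  ultimately have "a' \<in> syz f" using a' by (simp add: syz_def)
  then obtain \<alpha> \<beta> \<gamma> where coef: "\<alpha> \<in> polys {S,U}" "\<beta> \<in> polys {S,U}" "\<gamma> \<in> polys {S,U}"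
    and a'_eq: "a' = \<alpha> \<cdot>\<^sub>v a + \<beta> \<cdot>\<^sub>v b + \<gamma> \<cdot>\<^sub>v c"
    using basis unfolding is_syz_basis_def by blast
  have "(e * \<alpha> - 1) \<cdot>\<^sub>v a + (e * \<beta>) \<cdot>\<^sub>v b + (e * \<gamma>) \<cdot>\<^sub>v c = 0\<^sub>v 4"
  proof (rule eq_vecI)
    fix i assume "i < dim_vec (0\<^sub>v 4 :: 'k mpol vec)"
    then have i: "i < 4" by simp
    have "a $ i = e * (\<alpha> * a $ i + \<beta> * b $ i + \<gamma> * c $ i)"
      using arg_cong[OF a_eq, of "\<lambda>w. w $ i"] arg_cong[OF a'_eq, of "\<lambda>w. w $ i"] a(1) a' car i
      by (simp add: add.assoc)
    then show "((e * \<alpha> - 1) \<cdot>\<^sub>v a + (e * \<beta>) \<cdot>\<^sub>v b + (e * \<gamma>) \<cdot>\<^sub>v c) $ i = 0\<^sub>v 4 $ i"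
      using a(1) car i by (simp add: algebra_simps)
  qed (use a(1) car in auto)
  moreover have "e * \<alpha> - 1 \<in> polys {S,U}" "e * \<beta> \<in> polys {S,U}" "e * \<gamma> \<in> polys {S,U}"
    using coef e_SU by (auto intro!: polys_diff polys_mult)
  ultimately have "e * \<alpha> - 1 = 0"
    using basis unfolding is_syz_basis_def by blast
  then have "1 = e * \<alpha>" by simp
  then show ?thesis by (rule dvdI)
qed

text \<open>If all these minors vanished, \<open>- c $ j\<close> and \<open>a $ j\<close> would be
  the coefficients of a nontrivial relation between \<open>a\<close> and \<open>c\<close>, for any
  nonzero entry \<open>a $ j\<close>.\<close>

lemma syz_basis_minors:
  fixes a :: "'k::field mpol vec"
  assumes basis: "is_syz_basis f a b c"
  shows "\<exists>i<4. \<exists>j<4. c $ i * a $ j \<noteq> c $ j * a $ i"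
proof (rule ccontr)
  assume "\<not> ?thesis"
  then have eq: "c $ i * a $ j = c $ j * a $ i" if "i < 4" "j < 4" for i j using that by blast
  have a: "a \<in> carrier_vec 4" "set\<^sub>v a \<subseteq> polys {S,U}" and c: "c \<in> carrier_vec 4" "set\<^sub>v c \<subseteq> polys {S,U}"
    and b: "b \<in> carrier_vec 4"
    using basis by (auto simp: is_syz_basis_def syz_def)
  obtain j where j: "j < 4" "a $ j \<noteq> 0"
    using syz_basis_nonzero[OF basis] a(1) by (metis carrier_vecD eq_vecI index_zero_vec)
  have "(- c $ j) \<cdot>\<^sub>v a + 0 \<cdot>\<^sub>v b + a $ j \<cdot>\<^sub>v c = 0\<^sub>v 4"
    by (rule eq_vecI) (use a b c eq[OF _ j(1)] in \<open>auto simp: mult.commute\<close>)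
  moreover have "a $ j \<in> polys {S,U}" "c $ j \<in> polys {S,U}"
    using a c j vec_setI[of a j] vec_setI[of c j] by auto
  ultimately have "a $ j = 0"
    using basis polys_uminus polys_0 unfolding is_syz_basis_def by blast
  with j show False by simp
qed

subsection \<open>Moving planes\<close>

lemma N_mat_mult:
  fixes g a :: "'k::field mpol vec"
  assumes "a \<in> carrier_vec 4"
  shows "N_mat g *\<^sub>v a \<in> carrier_vec 4"
    "(N_mat g *\<^sub>v a) $ 0 = Const (1/2) * (g $ 0 * a $ 0 - g $ 1 * a $ 1 - g $ 2 * a $ 2 - g $ 3 * a $ 3)"
    "\<And>i. 1 \<le> i \<Longrightarrow> i < 4 \<Longrightarrow> (N_mat g *\<^sub>v a) $ i = g $ 0 * a $ i"
proof -
  have sum4: "(\<Sum>i = 0..<4. s i) = s 0 + s 1 + s 2 + s (3::nat)" for s :: "nat \<Rightarrow> 'k mpol"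
    by (simp add: numeral_eq_Suc)
  have dim: "dim_row (N_mat g) = 4" "dim_col (N_mat g) = 4"
    by (simp_all add: N_mat_def mat_of_rows_list_def)
  show "N_mat g *\<^sub>v a \<in> carrier_vec 4"
    by (rule carrier_vecI) (simp add: dim)
  have entry: "(N_mat g *\<^sub>v a) $ i = (\<Sum>j = 0..<4. N_mat g $$ (i, j) * a $ j)" if "i < 4" for i
    using that carrier_vecD[OF assms] by (simp add: scalar_prod_def dim)
  show "(N_mat g *\<^sub>v a) $ 0 = Const (1/2) * (g $ 0 * a $ 0 - g $ 1 * a $ 1 - g $ 2 * a $ 2 - g $ 3 * a $ 3)"
    by (subst entry) (simp_all add: sum4 N_mat_def mat_of_rows_list_def algebra_simps)
  show "(N_mat g *\<^sub>v a) $ i = g $ 0 * a $ i" if "1 \<le> i" "i < 4" for i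
  proof -
    have "i = 1 \<or> i = 2 \<or> i = 3" using that by auto
    then show ?thesis
      by (subst entry[OF that(2)]) (auto simp: sum4 N_mat_def mat_of_rows_list_def)
  qed
qed

lemma moving_plane_eq:
  assumes "A \<in> carrier_vec 4"
  shows "moving_plane A = A $ 0 * Var W + A $ 1 * Var X + A $ 2 * Var Y + A $ 3 * Var Z"
proof -
  have "dim_vec A = 4" using assms by simp
  then show ?thesis
    unfolding moving_plane_def scalar_prod_def by (simp add: numeral_eq_Suc mult.commute)
qed

text \<open>Recovers the vector from its plane, so that divisibility between planes can be read off
  entry by entry.\<close>

lemma cf_moving_plane:
  fixes A :: "'k::field mpol vec"
  assumes A: "A \<in> carrier_vec 4" "\<And>i. i < 4 \<Longrightarrow> A $ i \<in> polys {S,U,T,V}"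
  shows "cf W 1 (moving_plane A) = A $ 0" "cf X 1 (moving_plane A) = A $ 1"
    "cf Y 1 (moving_plane A) = A $ 2" "cf Z 1 (moving_plane A) = A $ 3"
proof -
  have "cf z 1 (A $ i * Var y) = (if z = y then A $ i else 0)"
    if i: "i < 4" and z: "z \<in> {W,X,Y,Z}" for i z y
  proof -
    have free: "A $ i \<in> polys (- {z})"
      by (rule polys_mono[OF A(2)[OF i]]) (use z in auto)
    show ?thesis
    proof (cases "z = y")
      case True
      then show ?thesis using cf_mult_Var_power[OF free, of 1 1] by simp
    next
      case False
      then have "A $ i * Var y \<in> polys (- {z})"
        by (intro polys_mult free polys_Var) auto
      then show ?thesis
        using False cf_mult_Var_power[of "A $ i * Var y" z 1 0] by simp
    qed
  qed
  then show "cf W 1 (moving_plane A) = A $ 0" "cf X 1 (moving_plane A) = A $ 1"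
    "cf Y 1 (moving_plane A) = A $ 2" "cf Z 1 (moving_plane A) = A $ 3"
    by (simp_all add: moving_plane_eq[OF A(1)] cf_add)
qed

lemma Const_mult_inverse: "c \<noteq> 0 \<Longrightarrow> Const c * Const (1 / c) = (1 :: 'k::field mpol)"
  by (simp add: Const_def mult_single)

lemma Const_eq_0_iff: "Const c = 0 \<longleftrightarrow> c = 0"
  unfolding Const_def by (metis lookup_single_eq lookup_zero single_zero)

lemma dvd_Const_mult_iff:
  fixes e p :: "'k::field mpol"
  assumes "c \<noteq> 0"
  shows "e dvd Const c * p \<longleftrightarrow> e dvd p"
proof
  assume "e dvd Const c * p"
  then have "e dvd Const c * p * Const (1 / c)" by (rule dvd_mult2)
  also have "Const c * p * Const (1 / c) = Const c * Const (1 / c) * p" by (simp add: ac_simps)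
  finally show "e dvd p" by (simp add: Const_mult_inverse[OF assms])
qed (rule dvd_mult)

text \<open>Collects what is used of a single syzygy, to be instantiated with \<open>a\<close>,
  \<open>b\<close> and \<open>c\<close>. The condition \<open>primitive\<close> comes from
  \<open>syz_basis_primitive\<close>.\<close>

locale plane =
  fixes g :: "'k::{alg_closed_field, field_char_0} mpol vec" and n :: nat
    and a A :: "'k mpol vec" and \<mu> :: nat
  assumes g: "g \<in> carrier_vec 4" "\<And>i. i < 4 \<Longrightarrow> g $ i \<in> polys {T,V} \<and> homog_in {T,V} n (g $ i)"
      "g $ 0 \<noteq> 0"
    and a: "a \<in> carrier_vec 4" "\<And>i. i < 4 \<Longrightarrow> a $ i \<in> polys {S,U} \<and> homog_in {S,U} \<mu> (a $ i)"
    and nonzero: "a \<noteq> 0\<^sub>v 4"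
    and primitive: "\<And>e. (\<And>i. i < 4 \<Longrightarrow> e dvd a $ i) \<Longrightarrow> e dvd 1"
    and A: "is_div_by_gcd A (N_mat g *\<^sub>v a)"
begin

definition content :: "'k mpol" where
  "content = (SOME d. is_gcd_of d (set\<^sub>v (N_mat g *\<^sub>v a)) \<and> N_mat g *\<^sub>v a = d \<cdot>\<^sub>v A)"

lemma content: "is_gcd_of content (set\<^sub>v (N_mat g *\<^sub>v a))" "N_mat g *\<^sub>v a = content \<cdot>\<^sub>v A"
proof -
  have "\<exists>d. is_gcd_of d (set\<^sub>v (N_mat g *\<^sub>v a)) \<and> N_mat g *\<^sub>v a = d \<cdot>\<^sub>v A"
    using A by (auto simp: is_div_by_gcd_def)
  from someI_ex[OF this] show "is_gcd_of content (set\<^sub>v (N_mat g *\<^sub>v a))" "N_mat g *\<^sub>v a = content \<cdot>\<^sub>v A"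
    by (simp_all add: content_def)
qed

lemma A_carrier: "A \<in> carrier_vec 4"
  using N_mat_mult(1)[OF a(1), of g] unfolding content(2) by simp

lemma entry: "i < 4 \<Longrightarrow> (N_mat g *\<^sub>v a) $ i = content * A $ i"
  using A_carrier by (simp add: content(2))

lemma entry_0: "content * A $ 0 =
    Const (1/2) * (g $ 0 * a $ 0 - g $ 1 * a $ 1 - g $ 2 * a $ 2 - g $ 3 * a $ 3)"
  using entry[of 0] N_mat_mult(2)[OF a(1)] by simp

lemma entry_pos: "1 \<le> i \<Longrightarrow> i < 4 \<Longrightarrow> content * A $ i = g $ 0 * a $ i"
  using entry[of i] N_mat_mult(3)[OF a(1)] by simp

text \<open>\<open>N_mat g\<close> is triangular with nonzero diagonal entries, so it does not
  annihilate the nonzero vector \<open>a\<close>.\<close>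

lemma entry_nonzero:
  obtains i where "i < 4" "content * A $ i \<noteq> 0"
proof -
  have "\<exists>i<4. content * A $ i \<noteq> 0"
  proof (rule ccontr)
    assume "\<not> ?thesis"
    then have zero: "content * A $ i = 0" if "i < 4" for i using that by blast
    have pos: "a $ i = 0" if "1 \<le> i" "i < 4" for i
      using entry_pos[OF that] zero[OF that(2)] g(3) by simp
    have "Const (1/2) * (g $ 0 * a $ 0) = 0"
      using entry_0 zero[of 0] pos[of 1] pos[of 2] pos[of 3] by simp
    then have "a $ 0 = 0" using g(3) by (simp add: Const_eq_0_iff)
    with pos have "a $ i = 0" if "i < 4" for i
      using that by (cases "i = 0") auto
    then have "a = 0\<^sub>v 4" using a(1) by (intro eq_vecI) auto
    with nonzero show False by simp
  qed
  with that show thesis by blast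
qed

lemma content_nonzero: "content \<noteq> 0"
  using entry_nonzero by fastforce

text \<open>Every entry of \<open>N_mat g *\<^sub>v a\<close> is a combination, with constant
  coefficients, of products \<open>g $ j * a $ l\<close>, all of which have the same
  bidegree.\<close>

lemma entry_homog:
  assumes "i < 4"
  shows "homog_in {S,U} \<mu> (content * A $ i)" "homog_in {T,V} n (content * A $ i)"
    "content * A $ i \<in> polys {S,U,T,V}"
proof -
  have prod: "homog_in {S,U} \<mu> (g $ j * a $ l)" "homog_in {T,V} n (g $ j * a $ l)"
    "g $ j * a $ l \<in> polys {S,U,T,V}" if "j < 4" "l < 4" for j l
  proof -
    show "homog_in {S,U} \<mu> (g $ j * a $ l)"
      using homog_in_mult[of "{S,U}" 0 "g $ j" \<mu> "a $ l"] g(2)[OF that(1)] a(2)[OF that(2)]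
        homog_in_polys[of "g $ j" "{T,V}" "{S,U}"] by auto
    show "homog_in {T,V} n (g $ j * a $ l)"
      using homog_in_mult[of "{T,V}" n "g $ j" 0 "a $ l"] g(2)[OF that(1)] a(2)[OF that(2)]
        homog_in_polys[of "a $ l" "{S,U}" "{T,V}"] by auto
    show "g $ j * a $ l \<in> polys {S,U,T,V}"
      by (rule polys_mult; rule polys_mono) (use g(2)[OF that(1)] a(2)[OF that(2)] in auto)
  qed
  have lin: "homog_in I k (content * A $ i)" if "\<And>j l. j < 4 \<Longrightarrow> l < 4 \<Longrightarrow> homog_in I k (g $ j * a $ l)" for I k
  proof (cases "i = 0")
    case True
    have "homog_in I k (g $ 0 * a $ 0 - g $ 1 * a $ 1 - g $ 2 * a $ 2 - g $ 3 * a $ 3)"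
      by (intro homog_in_diff that) simp_all
    then show ?thesis
      using True entry_0 homog_in_mult[OF homog_in_Const[of I "1/2::'k"]] by simp
  next
    case False
    with assms that[of 0 i] entry_pos[of i] show ?thesis by simp
  qed
  show "homog_in {S,U} \<mu> (content * A $ i)" "homog_in {T,V} n (content * A $ i)"
    by (rule lin, rule prod; assumption)+
  show "content * A $ i \<in> polys {S,U,T,V}"
    using prod(3) unfolding polys_iff_homog by (rule lin)
qed

lemma A_polys: "i < 4 \<Longrightarrow> A $ i \<in> polys {S,U,T,V}"
  using polys_factor(2)[OF entry_homog(3)] content_nonzero by (cases "A $ i = 0") auto

text \<open>One nonzero entry fixes the degree of the content; since that degree is unique, the
  complementary degree is the same for every entry of \<open>A\<close>.\<close>

lemma entry_factor_homog:
  assumes "\<And>i. i < 4 \<Longrightarrow> homog_in I k (content * A $ i)"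
  obtains \<delta> \<epsilon> where "\<delta> + \<epsilon> = k" "homog_in I \<delta> content" "\<forall>i<4. homog_in I \<epsilon> (A $ i)"
proof -
  obtain j where j: "j < 4" "content * A $ j \<noteq> 0" by (rule entry_nonzero)
  obtain \<delta> \<epsilon> where \<delta>: "\<delta> + \<epsilon> = k" "homog_in I \<delta> content" "homog_in I \<epsilon> (A $ j)"
    using assms[OF j(1)] j(2) by (rule homog_in_factor)
  have "homog_in I \<epsilon> (A $ i)" if i: "i < 4" for i
  proof (cases "A $ i = 0")
    case False
    then have "content * A $ i \<noteq> 0" using content_nonzero by simp
    with assms[OF i] obtain \<delta>' \<epsilon>' where *: "\<delta>' + \<epsilon>' = k" "homog_in I \<delta>' content" "homog_in I \<epsilon>' (A $ i)"
      by (rule homog_in_factor)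
    with \<delta> have "\<delta>' = \<delta>" using homog_in_unique content_nonzero by blast
    with * \<delta> show ?thesis by (metis add_left_cancel)
  qed simp
  with \<delta> that show thesis by blast
qed

text \<open>Specializing \<open>t, v\<close> to values where \<open>g\<^sub>0\<close> does not vanish turns the content into a common
  divisor of the entries of \<open>a\<close> without changing its degree in \<open>s, u\<close>.\<close>

lemma content_homog_SU: "homog_in {S,U} \<delta> content \<Longrightarrow> \<delta> = 0"
proof -
  assume \<delta>: "homog_in {S,U} \<delta> content"
  obtain \<tau> where \<tau>: "eval_mpol id \<tau> (g $ 0) \<noteq> 0"
    using g(3) by (rule eval_mpol_nonzero)
  \<comment> \<open>Keeps \<open>s\<close>, \<open>u\<close> as variables and makes every other
    variable constant, so the entries of \<open>a\<close> are fixed and those of \<open>g\<close>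
    become constants.\<close>
  define \<sigma> :: "var \<Rightarrow> 'k mpol" where "\<sigma> i = (if i \<in> {S,U} then Var i else Const (\<tau> i))" for i
  define ev where "ev = eval_mpol Const \<sigma>"
  interpret ev: comm_ring_hom ev
    unfolding ev_def by (rule comm_ring_hom_eval[OF comm_ring_hom_Const])
  interpret C: comm_ring_hom "Const :: 'k \<Rightarrow> 'k mpol" by (rule comm_ring_hom_Const)
  have ev_a: "ev (a $ i) = a $ i" if "i < 4" for i
  proof -
    have "ev (a $ i) = eval_mpol Const Var (a $ i)"
      unfolding ev_def by (rule eval_mpol_cong[of _ "{S,U}"]) (use a(2)[OF that] in \<open>auto simp: \<sigma>_def\<close>)
    then show ?thesis by (simp add: eval_mpol_Const_Var)
  qed
  have ev_g: "ev (g $ i) = Const (eval_mpol id \<tau> (g $ i))" if "i < 4" for i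
  proof -
    have "ev (g $ i) = eval_mpol (\<lambda>a. Const (id a)) (\<lambda>i. Const (\<tau> i)) (g $ i)"
      unfolding ev_def id_def
      by (rule eval_mpol_cong[of _ "{T,V}"]) (use g(2)[OF that] in \<open>auto simp: \<sigma>_def\<close>)
    then show ?thesis by (simp only: C.hom_eval_mpol)
  qed
  have ev_content: "ev content dvd ev (content * A $ i)" for i
    by (simp add: ev.hom_mult)
  have pos: "ev content dvd a $ i" if "1 \<le> i" "i < 4" for i
    using ev_content[of i] entry_pos[OF that] that \<tau>
    by (simp add: ev.hom_mult ev_a ev_g dvd_Const_mult_iff)
  have half: "ev (Const (1/2)) = Const (1/2)" by (simp add: ev_def)
  have "ev content dvd ev (g $ 0) * a $ 0 - ev (g $ 1) * a $ 1 - ev (g $ 2) * a $ 2 - ev (g $ 3) * a $ 3"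
    using ev_content[of 0] unfolding entry_0
    by (simp add: ev.hom_mult ev.hom_minus half ev_a dvd_Const_mult_iff)
  \<comment> \<open>Adding back the last three products, already known to be divisible, leaves a
    nonzero constant times \<open>a $ 0\<close>.\<close>
  then have "ev content dvd (ev (g $ 0) * a $ 0 - ev (g $ 1) * a $ 1 - ev (g $ 2) * a $ 2 - ev (g $ 3) * a $ 3)
      + ev (g $ 1) * a $ 1 + ev (g $ 2) * a $ 2 + ev (g $ 3) * a $ 3"
    by (intro dvd_add dvd_mult pos) simp_all
  then have "ev content dvd a $ 0"
    using \<tau> by (simp add: ev_g dvd_Const_mult_iff)
  with pos have "ev content dvd a $ i" if "i < 4" for i
    using that by (cases "i = 0") auto
  then have "ev content dvd 1" by (rule primitive)
  then have unit: "homog_in {S,U} 0 (ev content)" "ev content \<noteq> 0"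
    by (auto intro: homog_in_unit)
  have "homog_in {S,U} \<delta> (ev content)"
    unfolding ev_def
  proof (rule eval_mpol_homog[OF \<delta>])
    show "homog_in {S,U} (if i \<in> {S,U} then 1 else 0) (\<sigma> i)" for i
      using homog_in_Var[of "{S,U}" i, where 'a = 'k] by (auto simp: \<sigma>_def)
  qed simp
  then show "\<delta> = 0" using unit homog_in_unique by blast
qed

lemma A_homog_SU: "i < 4 \<Longrightarrow> homog_in {S,U} \<mu> (A $ i)"
  using entry_factor_homog[OF entry_homog(1)] content_homog_SU by (metis add_0)

lemma moving_plane_homog:
  assumes "\<And>i. i < 4 \<Longrightarrow> homog_in I k (A $ i)" "I \<inter> {W,X,Y,Z} = {}"
  shows "homog_in I k (moving_plane A)"
proof -
  have "homog_in I (k + 0) (A $ i * Var y)" if "i < 4" "y \<in> {W,X,Y,Z}" for i y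
    using assms that homog_in_Var[of I y, where 'a = 'k] by (intro homog_in_mult) auto
  then show ?thesis
    unfolding moving_plane_eq[OF A_carrier] by (intro homog_in_add) auto
qed

lemma moving_plane_homog_WXYZ: "homog_in {W,X,Y,Z} 1 (moving_plane A)"
proof -
  have "homog_in {W,X,Y,Z} (0 + 1) (A $ i * Var y)" if "i < 4" "y \<in> {W,X,Y,Z}" for i y
    using that homog_in_Var[of "{W,X,Y,Z}" y, where 'a = 'k]
    by (intro homog_in_mult homog_in_polys[OF A_polys]) auto
  then show ?thesis
    unfolding moving_plane_eq[OF A_carrier] by (intro homog_in_add) auto
qed

lemma moving_plane_nonzero: "moving_plane A \<noteq> 0"
proof
  assume zero: "moving_plane A = 0"
  obtain i where i: "i < 4" "content * A $ i \<noteq> 0" by (rule entry_nonzero)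
  then have "i = 0 \<or> i = 1 \<or> i = 2 \<or> i = 3" by auto
  then have "A $ i = 0"
    using cf_moving_plane[OF A_carrier A_polys] by (auto simp: zero)
  with i show False by simp
qed

text \<open>A factor free of \<open>w, x, y, z\<close> divides every coefficient of the plane. Its
  product with \<open>content\<close> is then a common divisor of the entries of
  \<open>N_mat g *\<^sub>v a\<close> and so divides their gcd \<open>content\<close>.\<close>

lemma moving_plane_factor:
  assumes "moving_plane A = p * q" "homog_in {W,X,Y,Z} 0 p"
  shows "p dvd 1"
proof -
  have free: "p \<in> polys (- {z})" if "z \<in> {W,X,Y,Z}" for z
    using assms(2) that by (auto simp: polys_iff_homog homog_in_def mon_deg_eq_0_iff)
  have "p dvd cf z 1 (moving_plane A)" if "z \<in> {W,X,Y,Z}" for z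
    unfolding assms(1) by (simp only: cf_mult_left[OF free[OF that]] dvd_triv_left)
  then have "p dvd A $ 0 \<and> p dvd A $ 1 \<and> p dvd A $ 2 \<and> p dvd A $ 3"
    using cf_moving_plane[OF A_carrier A_polys] by (metis insertCI)
  then have "p dvd A $ i" if "i < 4" for i
    using all_less_4[of "\<lambda>i. p dvd A $ i"] that by blast
  then have "content * p dvd y" if "y \<in> set\<^sub>v (N_mat g *\<^sub>v a)" for y
    using that A_carrier unfolding content(2) by (auto simp: vec_set_def intro: mult_dvd_mono)
  then have "content * p dvd content"
    using content(1) by (simp add: is_gcd_of_def)
  then show ?thesis
    using content_nonzero by (metis dvd_times_left_cancel_iff mult.right_neutral)
qed

text \<open>By linearity in \<open>w, x, y, z\<close>, one of any two factors has degree 0 in them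
  and is thus a unit.\<close>

lemma moving_plane_prime: "prime_elem (moving_plane A)"
proof (rule irreducible_imp_prime_mpol, rule irreducibleI)
  show "moving_plane A \<noteq> 0" by (rule moving_plane_nonzero)
  show "\<not> moving_plane A dvd 1"
  proof
    assume "moving_plane A dvd 1"
    then have "homog_in {W,X,Y,Z} 0 (moving_plane A)" by (rule homog_in_unit)
    then show False
      using homog_in_unique[OF moving_plane_homog_WXYZ _ moving_plane_nonzero] by fastforce
  qed
  fix p q assume pq: "moving_plane A = p * q"
  obtain i j where "i + j = 1" "homog_in {W,X,Y,Z} i p" "homog_in {W,X,Y,Z} j q"
    using moving_plane_homog_WXYZ moving_plane_nonzero unfolding pq by (rule homog_in_factor)
  then have "homog_in {W,X,Y,Z} 0 p \<or> homog_in {W,X,Y,Z} 0 q"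
    by (metis One_nat_def add_is_1)
  then show "p dvd 1 \<or> q dvd 1"
    using moving_plane_factor[OF pq] moving_plane_factor[of q p] pq by (auto simp: mult.commute)
qed

lemma moving_plane_homog_SU: "homog_in {S,U} \<mu> (moving_plane A)"
  by (rule moving_plane_homog) (auto simp: A_homog_SU)

lemma moving_plane_homog_TV: obtains k where "homog_in {T,V} k (moving_plane A)"
proof -
  obtain \<delta> \<epsilon> where "\<delta> + \<epsilon> = n" "homog_in {T,V} \<delta> content" "\<forall>i<4. homog_in {T,V} \<epsilon> (A $ i)"
    using entry_homog(2) by (rule entry_factor_homog)
  then have "homog_in {T,V} \<epsilon> (moving_plane A)"
    by (intro moving_plane_homog) auto
  then show thesis by (rule that)
qed

end

text \<open>If one plane divided the other, the two syzygies would be proportional.\<close>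

lemma planes_not_dvd:
  fixes a c A C g :: "'k::{alg_closed_field, field_char_0} mpol vec"
  assumes "plane g n a A \<mu>" "plane g n c C \<nu>"
    and ind: "\<exists>i<4. \<exists>j<4. c $ i * a $ j \<noteq> c $ j * a $ i"
  shows "\<not> moving_plane A dvd moving_plane C"
proof
  interpret A: plane g n a A \<mu> by fact
  interpret C: plane g n c C \<nu> by fact
  assume "moving_plane A dvd moving_plane C"
  then obtain r where r: "moving_plane C = moving_plane A * r" ..
  have "homog_in {W,X,Y,Z} 1 (moving_plane A * r)" "moving_plane A * r \<noteq> 0"
    using C.moving_plane_homog_WXYZ C.moving_plane_nonzero unfolding r by simp_all
  then obtain i j where ij: "i + j = 1" "homog_in {W,X,Y,Z} i (moving_plane A)" "homog_in {W,X,Y,Z} j r"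
    by (rule homog_in_factor)
  then have "i = 1"
    using homog_in_unique[OF A.moving_plane_homog_WXYZ _ A.moving_plane_nonzero] by auto
  \<comment> \<open>Both planes are linear in \<open>w, x, y, z\<close>, so the quotient
    \<open>r\<close> is free of them and \<open>C\<close> is \<open>r\<close> times \<open>A\<close>
    entrywise.\<close>
  with ij have r0: "homog_in {W,X,Y,Z} 0 r" by simp
  have free: "r \<in> polys (- {z})" if "z \<in> {W,X,Y,Z}" for z
    using r0 that by (auto simp: polys_iff_homog homog_in_def mon_deg_eq_0_iff)
  have cf_r: "cf z 1 (moving_plane C) = r * cf z 1 (moving_plane A)" if "z \<in> {W,X,Y,Z}" for z
    unfolding r mult.commute[of "moving_plane A"] by (rule cf_mult_left[OF free[OF that]])
  have "C $ 0 = r * A $ 0 \<and> C $ 1 = r * A $ 1 \<and> C $ 2 = r * A $ 2 \<and> C $ 3 = r * A $ 3"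
    using cf_r[of W] cf_r[of X] cf_r[of Y] cf_r[of Z]
      cf_moving_plane[OF A.A_carrier A.A_polys] cf_moving_plane[OF C.A_carrier C.A_polys] by simp
  then have CA: "C $ i = r * A $ i" if "i < 4" for i
    using all_less_4[of "\<lambda>i. C $ i = r * A $ i"] that by blast
  \<comment> \<open>Clearing both contents gives proportional vectors
    \<open>N_mat g *\<^sub>v c\<close> and \<open>N_mat g *\<^sub>v a\<close>. Undoing the
    triangular matrix, last three rows first, gives
    \<open>\<alpha> * c $ i = \<gamma> * a $ i\<close>.\<close>
  define \<alpha> \<gamma> where "\<alpha> = A.content" and "\<gamma> = C.content * r"
  have rel: "\<alpha> * (C.content * C $ i) = \<gamma> * (A.content * A $ i)" if "i < 4" for i
    by (simp add: CA[OF that] \<alpha>_def \<gamma>_def ac_simps)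
  have pos: "\<alpha> * c $ i = \<gamma> * a $ i" if "1 \<le> i" "i < 4" for i
  proof -
    have "g $ 0 * (\<alpha> * c $ i) = g $ 0 * (\<gamma> * a $ i)"
      using rel[OF that(2)] A.entry_pos[OF that] C.entry_pos[OF that] by (simp add: ac_simps)
    then show ?thesis using A.g(3) by simp
  qed
  have "\<alpha> * c $ 0 = \<gamma> * a $ 0"
  proof -
    have "Const (1/2) * (\<alpha> * (g $ 0 * c $ 0 - g $ 1 * c $ 1 - g $ 2 * c $ 2 - g $ 3 * c $ 3)) =
        Const (1/2) * (\<gamma> * (g $ 0 * a $ 0 - g $ 1 * a $ 1 - g $ 2 * a $ 2 - g $ 3 * a $ 3))"
      using rel[of 0] A.entry_0 C.entry_0 by (simp add: ac_simps)
    then have "\<alpha> * (g $ 0 * c $ 0 - g $ 1 * c $ 1 - g $ 2 * c $ 2 - g $ 3 * c $ 3) =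
        \<gamma> * (g $ 0 * a $ 0 - g $ 1 * a $ 1 - g $ 2 * a $ 2 - g $ 3 * a $ 3)"
      by (simp add: Const_eq_0_iff)
    then have "g $ 0 * (\<alpha> * c $ 0) - g $ 1 * (\<alpha> * c $ 1) - g $ 2 * (\<alpha> * c $ 2) - g $ 3 * (\<alpha> * c $ 3) =
        g $ 0 * (\<gamma> * a $ 0) - g $ 1 * (\<gamma> * a $ 1) - g $ 2 * (\<gamma> * a $ 2) - g $ 3 * (\<gamma> * a $ 3)"
      by (simp add: algebra_simps)
    then have "g $ 0 * (\<alpha> * c $ 0) = g $ 0 * (\<gamma> * a $ 0)"
      using pos[of 1] pos[of 2] pos[of 3] by simp
    then show ?thesis using A.g(3) by simp
  qed
  with pos have ac: "\<alpha> * c $ i = \<gamma> * a $ i" if "i < 4" for i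
    using that by (cases "i = 0") auto
  have "c $ i * a $ j = c $ j * a $ i" if "i < 4" "j < 4" for i j
  proof -
    have "\<alpha> * (c $ i * a $ j) = (\<alpha> * c $ i) * a $ j" by (simp add: mult.assoc)
    also have "\<dots> = (\<alpha> * c $ j) * a $ i" unfolding ac[OF that(1)] ac[OF that(2)] by (simp add: ac_simps)
    also have "\<dots> = \<alpha> * (c $ j * a $ i)" by (simp add: mult.assoc)
    finally show ?thesis using A.content_nonzero by (simp add: \<alpha>_def)
  qed
  with ind show False by blast
qed

text \<open>The resultant in \<open>s, u\<close> is a nonzero form in \<open>t, v\<close>, hence so
  is each of its factors. In particular \<open>deg_in {T,V} F\<close> is the true degree of the
  form, the one that sizes the Sylvester matrix of the final resultant.\<close>

lemma planes_resultant:
  fixes a c A C g :: "'k::{alg_closed_field, field_char_0} mpol vec"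
  assumes "plane g n a A \<mu>" "plane g n c C \<nu>"
    and ind: "\<exists>i<4. \<exists>j<4. c $ i * a $ j \<noteq> c $ j * a $ i"
    and F: "F dvd hom_resultant S U \<mu> \<nu> (moving_plane A) (moving_plane C)"
  shows "F \<noteq> 0" "homog_in {T,V} (deg_in {T,V} F) F"
proof -
  interpret A: plane g n a A \<mu> by fact
  interpret C: plane g n c C \<nu> by fact
  let ?R = "hom_resultant S U \<mu> \<nu> (moving_plane A) (moving_plane C)"
  obtain r where r: "?R = F * r" using F ..
  have nz: "?R \<noteq> 0"
    by (rule hom_resultant_nonzero[OF _ A.moving_plane_homog_SU C.moving_plane_homog_SU
          A.moving_plane_prime planes_not_dvd[OF assms(1-3)]]) simp
  then show "F \<noteq> 0" using r by auto
  obtain k where k: "homog_in {T,V} k (moving_plane A)" by (rule A.moving_plane_homog_TV)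
  obtain l where l: "homog_in {T,V} l (moving_plane C)" by (rule C.moving_plane_homog_TV)
  have "homog_in {T,V} (\<nu> * k + \<mu> * l) ?R"
    by (rule hom_resultant_homog[OF _ k l]) simp_all
  then obtain i j where "i + j = \<nu> * k + \<mu> * l" "homog_in {T,V} i F" "homog_in {T,V} j r"
    using nz unfolding r by (rule homog_in_factor)
  then show "homog_in {T,V} (deg_in {T,V} F) F"
    using deg_in_homog \<open>F \<noteq> 0\<close> by metis
qed

subsection \<open>The resultant of two moving surfaces\<close>

theorem proposition3p10:
  fixes f g h a b c A B C :: "'k::{alg_closed_field, field_char_0} mpol vec"
    and F0 F1 :: "'k mpol"
    and m n \<mu>1 \<mu>2 \<mu>3 :: nat
  assumes "m \<ge> 1" and "n \<ge> 1"
    and f: "f \<in> carrier_vec 4" "\<And>i. i < 4 \<Longrightarrow> f $ i \<in> polys {S,U} \<and> homog_in {S,U} m (f $ i)"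
           "is_gcd_of 1 (set\<^sub>v f)" "f $ 0 \<noteq> 0"
    and g: "g \<in> carrier_vec 4" "\<And>i. i < 4 \<Longrightarrow> g $ i \<in> polys {T,V} \<and> homog_in {T,V} n (g $ i)"
           "is_gcd_of 1 (set\<^sub>v g)" "g $ 0 \<noteq> 0"
    and h: "h = par_map f g"
    and surface: "zariski_dim (zariski_closure (image_of h)) = 2"
    and basis: "is_syz_basis f a b c"
    and degs: "\<And>i. i < 4 \<Longrightarrow> homog_in {S,U} \<mu>1 (a $ i)"
              "\<And>i. i < 4 \<Longrightarrow> homog_in {S,U} \<mu>2 (b $ i)"
              "\<And>i. i < 4 \<Longrightarrow> homog_in {S,U} \<mu>3 (c $ i)"
              "\<mu>1 \<le> \<mu>2" "\<mu>2 \<le> \<mu>3" "\<mu>1 + \<mu>2 + \<mu>3 = m"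
    and A: "is_div_by_gcd A (N_mat g *\<^sub>v a)"
    and B: "is_div_by_gcd B (N_mat g *\<^sub>v b)"
    and C: "is_div_by_gcd C (N_mat g *\<^sub>v c)"
    and F0: "F0 \<in> polys {T,V,W,X,Y,Z}" "irreducible F0" "follows F0 h"
            "F0 dvd hom_resultant S U \<mu>1 \<mu>3 (moving_plane A) (moving_plane C)"
    and F1: "F1 \<in> polys {T,V,W,X,Y,Z}" "irreducible F1" "follows F1 h"
            "F1 dvd hom_resultant S U \<mu>2 \<mu>3 (moving_plane B) (moving_plane C)"
    and not_assoc: "\<not> (\<exists>e. e dvd 1 \<and> F1 = e * F0)"
  defines "Res \<equiv> hom_resultant T V (deg_in {T,V} F0) (deg_in {T,V} F1) F0 F1"
  shows "Res \<in> polys {W,X,Y,Z} \<and> Res \<noteq> 0 \<and>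
    (\<forall>F. is_implicit_equation h F \<longrightarrow> (\<exists>E\<in>polys {W,X,Y,Z}. Res = E * F))"
proof -
  let ?d = "deg_in {T,V} F0" and ?e = "deg_in {T,V} F1"
  have plane: "plane g n p P \<mu>"
    if "is_syz_basis f p q r" "\<And>i. i < 4 \<Longrightarrow> homog_in {S,U} \<mu> (p $ i)" "is_div_by_gcd P (N_mat g *\<^sub>v p)"
    for p q r P \<mu>
  proof
    have p: "p \<in> carrier_vec 4" "set\<^sub>v p \<subseteq> polys {S,U}"
      using that(1) by (auto simp: is_syz_basis_def syz_def)
    then show "p \<in> carrier_vec 4" by simp
    show "p $ i \<in> polys {S,U} \<and> homog_in {S,U} \<mu> (p $ i)" if "i < 4" for i
      using p that \<open>\<And>i. i < 4 \<Longrightarrow> homog_in {S,U} \<mu> (p $ i)\<close> vec_setI[of p i] by auto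
    show "p \<noteq> 0\<^sub>v 4" by (rule syz_basis_nonzero[OF that(1)])
    show "e dvd 1" if "\<And>i. i < 4 \<Longrightarrow> e dvd p $ i" for e
      using \<open>is_syz_basis f p q r\<close> f(1) that by (rule syz_basis_primitive)
  qed (use g that(3) in auto)
  note plane_a = plane[OF basis degs(1) A]
    and plane_b = plane[OF syz_basis_permute(1)[OF basis] degs(2) B]
    and plane_c = plane[OF syz_basis_permute(2)[OF basis] degs(3) C]
  have F0_hom: "homog_in {T,V} ?d F0" "F0 \<noteq> 0"
    using planes_resultant[OF plane_a plane_c syz_basis_minors[OF basis] F0(4)] by simp_all
  have F1_hom: "homog_in {T,V} ?e F1" "F1 \<noteq> 0"
    using planes_resultant[OF plane_b plane_c syz_basis_minors[OF syz_basis_permute(1)[OF basis]] F1(4)]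
    by simp_all
  \<comment> \<open>The cofactor of \<open>F0\<close> in the irreducible \<open>F1\<close> would be
    a unit, since \<open>F0\<close> is not one.\<close>
  have ndvd: "\<not> F0 dvd F1"
  proof
    assume "F0 dvd F1"
    then obtain r where r: "F1 = r * F0" by (metis dvdE mult.commute)
    then have "r dvd 1"
      using irreducibleD[OF F1(2) r] F0(2) by (auto simp: irreducible_def)
    with r not_assoc show False by blast
  qed
  have nz: "Res \<noteq> 0"
    unfolding Res_def
    by (rule hom_resultant_nonzero[OF _ F0_hom(1) F1_hom(1) irreducible_imp_prime_mpol[OF F0(2)] ndvd]) simp
  have "{T,V,W,X,Y,Z} - {T,V} = {W,X,Y,Z}" by auto
  then have polys: "Res \<in> polys {W,X,Y,Z}"
    using hom_resultant_polys[OF _ F0(1) F1(1), of T V ?d ?e] by (simp add: Res_def)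
  have dim_h: "dim_vec h = 4" by (simp add: h par_map_def)
  obtain k l where kl: "homog_in {W,X,Y,Z} k F0" "homog_in {W,X,Y,Z} l F1"
    using F0(3) F1(3) unfolding follows_def by blast
  have par: "subst_par h F0 = 0" "subst_par h F1 = 0"
    using F0(3) F1(3) by (simp_all add: follows_def)
  have "\<exists>E\<in>polys {W,X,Y,Z}. Res = E * F" if F: "is_implicit_equation h F" for F
  proof -
    have "F dvd Res"
    proof (cases "?d + ?e > 0")
      case True
      then have "subst_par h Res = 0"
        unfolding Res_def using F0_hom F1_hom par by (intro subst_par_hom_resultant) auto
      moreover have "homog_in {W,X,Y,Z} (?e * k + ?d * l) Res"
        unfolding Res_def by (rule hom_resultant_homog[OF _ kl]) simp_all
      then have "Res \<in> forms" using polys by (auto simp: forms_def)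
      ultimately show ?thesis using implicit_equation_dvd[OF F _ _ dim_h] by blast
    next
      \<comment> \<open>Both degrees in \<open>t, v\<close> are 0, so \<open>F0\<close> and
        \<open>F1\<close> are themselves forms in \<open>w, x, y, z\<close> vanishing on the
        image.\<close>
      case False
      have "{T,V,W,X,Y,Z} \<inter> - {T,V} = {W,X,Y,Z}" by auto
      then have "F0 \<in> polys {W,X,Y,Z}" "F1 \<in> polys {W,X,Y,Z}"
        using polys_inter[OF F0(1), of "- {T,V}"] polys_inter[OF F1(1), of "- {T,V}"] False F0_hom F1_hom
        by (simp_all add: polys_iff_homog[of _ "- {T,V}"])
      then have "F0 \<in> forms" "F1 \<in> forms"
        using kl by (auto simp: forms_def)
      then have "F dvd F0" "F dvd F1"
        using implicit_equation_dvd[OF F _ _ dim_h] par by blast+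
      moreover have "\<not> F dvd 1"
        using F by (simp add: is_implicit_equation_def irreducible_def)
      ultimately have "F0 dvd F1"
        \<comment> \<open>The nonunit \<open>F\<close> divides the irreducible \<open>F0\<close>, so
          \<open>F0\<close> in turn divides \<open>F\<close> and therefore
          \<open>F1\<close>.\<close>
        using F0(2) by (metis dvd_trans irreducible_altdef)
      with ndvd show ?thesis by blast
    qed
    then obtain E where E: "Res = E * F" by (metis dvdE mult.commute)
    then have "E \<in> polys {W,X,Y,Z}"
      using polys nz polys_factor(1) by metis
    with E show ?thesis by blast
  qed
  with polys nz show ?thesis by blast
qed

end
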